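(* Let $x_0>0$ and $\mathcal A_0>\frac32\pi x_0^2$, let $L=L(x_0,\mathcal A_0)$, $\gamma=\gamma(x_0,L)$ with unit normal $N$, and $\lambda=\lambda(x_0,L)$. There exists $\varepsilon=\varepsilon(x_0,\mathcal A_0)>0$ such that for every $\varphi\in\mathcal W_1\cap C^2[0,2L]$ with $\varphi\not\equiv0$ and $\|\varphi\|_{C^2[0,2L]}\le\varepsilon$, $$(\mathcal F-\lambda\mathcal A)(\gamma)<(\mathcal F-\lambda\mathcal A)(\gamma+\varphi N).$$ In particular, if in addition $\mathcal A(\gamma+\varphi N)=\mathcal A(\gamma)$, then $\mathcal F(\gamma)<\mathcal F(\gamma+\varphi N)$.
   Context: Notation: $(\xi,\eta)^\perp=(\eta,-\xi)$. For a regular curve $\eta=(\eta_1,\eta_2)\in C^2([0,2L],\mathbb R^2)$ with $\langle\dot\eta,\ddot\eta^\perp\rangle>0$, set $\mathcal F(\eta)=\int_0^{2L}\frac{|\dot\eta|^4}{\langle\dot\eta,\ddot\eta^\perp\rangle}ds$ (equal to $\int_0^{2L}|\dot\eta|H^{-1}ds$ with curvature $H=\langle\dot\eta,\ddot\eta^\perp\rangle/|\dot\eta|^3$) and $\mathcal A(\eta)=\frac12\int_0^{2L}(\eta_1\dot\eta_2-\dot\eta_1\eta_2)ds$. For $0<3x_0<L$: $\lambda(x_0,L)=\frac{2L}{L+x_0}$; with $\sigma=\pi\sqrt{x_0/(L+x_0)}$, $k=L/\sin\sigma$, $a(s)=\arcsin((s-L)/k)$, $\gamma(x_0,L)=(x,y)$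 on $[0,2L]$ with $x(s)=-\frac k2\big(\frac{\sigma}{\pi+\sigma}\sin(\tfrac{\pi+\sigma}{\sigma}a(s))+\frac{\sigma}{\pi-\sigma}\sin(\tfrac{\pi-\sigma}{\sigma}a(s))\big)$, $y(s)=\frac k2\big(\frac{\sigma}{\pi+\sigma}\cos(\tfrac{\pi+\sigma}{\sigma}a(s))+\frac{\sigma}{\pi-\sigma}\cos(\tfrac{\pi-\sigma}{\sigma}a(s))\big)+\frac{\pi x_0}{\sigma\tan\sigma}$; it is arc-length parametrized with $N=\dot\gamma^\perp$ and positive curvature. For $\mathcal A_0>\frac32\pi x_0^2$, $L(x_0,\mathcal A_0)$ is the unique $L>3x_0$ with $\mathcal A(\gamma(x_0,L))=\mathcal A_0$. $\mathcal W_1=\{\varphi\in W^{2,2}(0,2L):\varphi(0)=\varphi(2L)=0,\ \dot\varphi(0)=\dot\varphi(2L)=0\}$. *)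

theory Defs
  imports "HOL-Analysis.Analysis"
begin

text \<open>Planar curves are functions real => real * real, parametrised on [0, 2L].
  Derivatives of the components are taken with deriv; the integrals only see
  interior points, where this is the ordinary derivative.\<close>

definition perp :: "real \<times> real \<Rightarrow> real \<times> real" where
  "perp v = (snd v, - fst v)"

definition crv_d1 :: "(real \<Rightarrow> real \<times> real) \<Rightarrow> real \<Rightarrow> real \<times> real" where
  "crv_d1 \<eta> s = (deriv (\<lambda>t. fst (\<eta> t)) s, deriv (\<lambda>t. snd (\<eta> t)) s)"

definition crv_d2 :: "(real \<Rightarrow> real \<times> real) \<Rightarrow> real \<Rightarrow> real \<times> real" where
  "crv_d2 \<eta> s = (deriv (deriv (\<lambda>t. fst (\<eta> t))) s, deriv (deriv (\<lambda>t. snd (\<eta> t))) s)"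

definition pinner :: "real \<times> real \<Rightarrow> real \<times> real \<Rightarrow> real" where
  "pinner u v = fst u * fst v + snd u * snd v"

definition FF :: "real \<Rightarrow> (real \<Rightarrow> real \<times> real) \<Rightarrow> real" where
  "FF L \<eta> = integral {0..2*L}
     (\<lambda>s. (pinner (crv_d1 \<eta> s) (crv_d1 \<eta> s))\<^sup>2 / pinner (crv_d1 \<eta> s) (perp (crv_d2 \<eta> s)))"

definition AA :: "real \<Rightarrow> (real \<Rightarrow> real \<times> real) \<Rightarrow> real" where
  "AA L \<eta> = 1/2 * integral {0..2*L}
     (\<lambda>s. fst (\<eta> s) * snd (crv_d1 \<eta> s) - fst (crv_d1 \<eta> s) * snd (\<eta> s))"

definition lam :: "real \<Rightarrow> real \<Rightarrow> real" where
  "lam x0 L = 2 * L / (L + x0)"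

definition sig :: "real \<Rightarrow> real \<Rightarrow> real" where
  "sig x0 L = pi * sqrt (x0 / (L + x0))"

definition kk :: "real \<Rightarrow> real \<Rightarrow> real" where
  "kk x0 L = L / sin (sig x0 L)"

definition aa :: "real \<Rightarrow> real \<Rightarrow> real \<Rightarrow> real" where
  "aa x0 L s = arcsin ((s - L) / kk x0 L)"

definition gamma_crv :: "real \<Rightarrow> real \<Rightarrow> real \<Rightarrow> real \<times> real" where
  "gamma_crv x0 L s =
    (let \<sigma> = sig x0 L; k = kk x0 L; a = aa x0 L s in
     ( - k / 2 * (\<sigma> / (pi + \<sigma>) * sin ((pi + \<sigma>) / \<sigma> * a)
                 + \<sigma> / (pi - \<sigma>) * sin ((pi - \<sigma>) / \<sigma> * a)),
       k / 2 * (\<sigma> / (pi + \<sigma>) * cos ((pi + \<sigma>) / \<sigma> * a)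
                 + \<sigma> / (pi - \<sigma>) * cos ((pi - \<sigma>) / \<sigma> * a))
       + pi * x0 / (\<sigma> * tan \<sigma>)))"

definition LL :: "real \<Rightarrow> real \<Rightarrow> real" where
  "LL x0 A0 = (THE L. 3 * x0 < L \<and> AA L (gamma_crv x0 L) = A0)"

definition perturb :: "(real \<Rightarrow> real \<times> real) \<Rightarrow> (real \<Rightarrow> real) \<Rightarrow> real \<Rightarrow> real \<times> real" where
  "perturb \<gamma> \<phi> s = \<gamma> s + \<phi> s *\<^sub>R perp (crv_d1 \<gamma> s)"

end

theory Submission
  imports Defs
begin

text \<open>
  Let \<open>\<rho>\<close> be the radius of curvature of the arc as a function of arc length, and \<open>\<mu> = \<sigma> / pi < 1/2\<close>.
  Along the perturbed curve the integrand of the functional is \<open>\<rho> n\<^sup>2 / D\<close>, where \<open>n\<close> is the squared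
  speed and \<open>D / \<rho>\<close> is the product of the velocity with the rotated acceleration. Since
  \<open>n\<^sup>2 / D \<ge> 2 \<tau> n - \<tau>\<^sup>2 D\<close> for every \<open>\<tau>\<close>, the choice \<open>\<tau> = 1 + \<rho> \<phi>''\<close> gives a
  polynomial lower bound that is exact to second order. The Euler equation \<open>(\<rho>\<^sup>2)'' = - 2 \<mu>\<^sup>2 = lam - 2\<close> turns
  its linear part into an exact derivative. In the angular variable \<open>t\<close> with \<open>ds = \<rho> dt\<close> the quadratic
  part has constant coefficients: it is the integral of
  \<open>\<phi>''\<^sup>2 - (1 + \<mu>\<^sup>2) \<phi>'\<^sup>2 + \<mu>\<^sup>2 \<phi>\<^sup>2\<close> over \<open>[-pi, pi]\<close>, i.e. the convex combination with weights
  \<open>1 - \<mu>\<^sup>2\<close> and \<open>\<mu>\<^sup>2\<close> of \<open>\<phi>''\<^sup>2 - \<phi>'\<^sup>2\<close>, which is nonnegative by Wirtinger's inequality,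
  and of \<open>(\<phi>'' + \<phi>)\<^sup>2\<close>, which is coercive on clamped functions. The cubic error is absorbed
  by this coercivity. That \<open>L\<close> is determined by the area holds because the area
  is a strictly decreasing function of \<open>\<sigma>\<close>, being a sum of products of decreasing positive factors.
\<close>

subsection \<open>Coercivity of the quadratic form\<close>

text \<open>Integrate the square of \<open>f' + c tan (c (x - m)) f\<close>; taking \<open>c < 1\<close> keeps the weight regular
  up to the end points of an interval of length \<open>pi\<close>.\<close>

lemma tan_weight_inequality:
  fixes f f' :: "real \<Rightarrow> real"
  assumes c: "0 < c" "c < 1" and ab: "m - pi/2 \<le> a" "a \<le> b" "b \<le> m + pi/2"
    and f: "\<And>x. x \<in> {a..b} \<Longrightarrow> (f has_real_derivative f' x) (at x within {a..b})"
    and f': "continuous_on {a..b} f'"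
  shows "c\<^sup>2 * integral {a..b} (\<lambda>x. (f x)\<^sup>2)
    \<le> integral {a..b} (\<lambda>x. (f' x)\<^sup>2)
      + (c * tan (c * (b - m)) * (f b)\<^sup>2 - c * tan (c * (a - m)) * (f a)\<^sup>2)"
proof -
  define T where "T x = tan (c * (x - m))" for x
  have cos: "cos (c * (x - m)) \<noteq> 0" if "x \<in> {a..b}" for x
  proof -
    have "\<bar>x - m\<bar> \<le> pi/2" using that ab by (intro abs_leI) auto
    then have "c * \<bar>x - m\<bar> \<le> c * (pi/2)" using c by (intro mult_left_mono) auto
    also have "\<dots> < pi/2" using c by (simp)
    finally have "\<bar>c * (x - m)\<bar> < pi/2" using c by (simp add: abs_mult)
    then have "cos (c * (x - m)) > 0" by (intro cos_gt_zero_pi) auto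
    then show ?thesis by simp
  qed
  have fc: "continuous_on {a..b} f"
    using f by (meson DERIV_continuous_on)
  have Tc: "continuous_on {a..b} T"
    unfolding T_def by (intro continuous_intros) (use cos in auto)
  have T': "(T has_real_derivative c * (1 + (T x)\<^sup>2)) (at x within {a..b})" if "x \<in> {a..b}" for x
  proof -
    have "(T has_real_derivative inverse ((cos (c * (x - m)))\<^sup>2) * c) (at x within {a..b})"
      unfolding T_def
      by (rule DERIV_chain2[of tan], rule DERIV_tan, rule cos[OF that]) (auto intro!: derivative_eq_intros)
    moreover have "inverse ((cos (c * (x - m)))\<^sup>2) = 1 + (T x)\<^sup>2"
      using tan_sec[OF cos[OF that]] by (simp add: T_def power_inverse)
    ultimately show ?thesis by (simp only: mult.commute)
  qed
  have "((\<lambda>x. c * T x * (f x)\<^sup>2) has_real_derivative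
      c\<^sup>2 * (1 + (T x)\<^sup>2) * (f x)\<^sup>2 + 2 * c * T x * f x * f' x) (at x within {a..b})"
    if "x \<in> {a..b}" for x
    by (rule derivative_eq_intros T'[OF that] f[OF that] refl)+
       (simp add: algebra_simps power2_eq_square)
  then have "((\<lambda>x. c\<^sup>2 * (1 + (T x)\<^sup>2) * (f x)\<^sup>2 + 2 * c * T x * f x * f' x) has_integral
      c * T b * (f b)\<^sup>2 - c * T a * (f a)\<^sup>2) {a..b}"
    using ab by (intro fundamental_theorem_of_calculus)
      (auto simp: has_real_derivative_iff_has_vector_derivative)
  moreover have "((\<lambda>x. (f' x)\<^sup>2) has_integral integral {a..b} (\<lambda>x. (f' x)\<^sup>2)) {a..b}"
    by (intro integrable_integral integrable_continuous_real continuous_intros f')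
  moreover have "((\<lambda>x. (f x)\<^sup>2) has_integral integral {a..b} (\<lambda>x. (f x)\<^sup>2)) {a..b}"
    by (intro integrable_integral integrable_continuous_real continuous_intros fc)
  ultimately have "((\<lambda>x. (f' x)\<^sup>2 + (c\<^sup>2 * (1 + (T x)\<^sup>2) * (f x)\<^sup>2 + 2 * c * T x * f x * f' x)
      - c\<^sup>2 * (f x)\<^sup>2) has_integral integral {a..b} (\<lambda>x. (f' x)\<^sup>2)
      + (c * T b * (f b)\<^sup>2 - c * T a * (f a)\<^sup>2) - c\<^sup>2 * integral {a..b} (\<lambda>x. (f x)\<^sup>2)) {a..b}"
    by (intro has_integral_diff has_integral_add has_integral_mult_right)
  moreover have "(f' x)\<^sup>2 + (c\<^sup>2 * (1 + (T x)\<^sup>2) * (f x)\<^sup>2 + 2 * c * T x * f x * f' x)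
      - c\<^sup>2 * (f x)\<^sup>2 = (f' x + c * T x * f x)\<^sup>2" for x
    by (simp add: power2_eq_square algebra_simps)
  ultimately have "((\<lambda>x. (f' x + c * T x * f x)\<^sup>2) has_integral integral {a..b} (\<lambda>x. (f' x)\<^sup>2)
      + (c * T b * (f b)\<^sup>2 - c * T a * (f a)\<^sup>2) - c\<^sup>2 * integral {a..b} (\<lambda>x. (f x)\<^sup>2)) {a..b}"
    by simp
  from has_integral_nonneg[OF this] show ?thesis by (simp add: T_def)
qed

text \<open>After subtraction of \<open>f t\<close> the function vanishes at two antipodal points of
  the circle, so \<open>tan_weight_inequality\<close> holds on the half circles between them without
  boundary terms; then c tends to 1. For mean zero, subtracting a constant can only increase the
  square integral.\<close>

lemma wirtinger_periodic:
  fixes f f' :: "real \<Rightarrow> real"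
  assumes f: "\<And>x. x \<in> {-pi..pi} \<Longrightarrow> (f has_real_derivative f' x) (at x within {-pi..pi})"
    and f': "continuous_on {-pi..pi} f'"
    and periodic: "f (-pi) = f pi" and mean: "integral {-pi..pi} f = 0"
  shows "integral {-pi..pi} (\<lambda>x. (f x)\<^sup>2) \<le> integral {-pi..pi} (\<lambda>x. (f' x)\<^sup>2)"
proof -
  have fc: "continuous_on {-pi..pi} f" using f by (meson DERIV_continuous_on)
  \<comment> \<open>Subtracting the common value at \<open>t\<close> and \<open>t + pi\<close> yields a function that vanishes at both ends of
    two arcs of length \<open>pi\<close> of the circle.\<close>
  have "\<exists>t\<ge>-pi. t \<le> 0 \<and> f t - f (t + pi) = 0"
  proof -
    have cont: "continuous_on {-pi..0} (\<lambda>t. f t - f (t + pi))"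
      by (intro continuous_intros continuous_on_subset[OF fc] continuous_on_compose2[OF fc]) auto
    show ?thesis
    proof (cases "f (-pi) \<le> f 0")
      case True
      then show ?thesis using IVT'[OF _ _ _ cont, of 0] periodic by auto
    next
      case False
      then show ?thesis using IVT2'[OF _ _ _ cont, of 0] periodic by auto
    qed
  qed
  then obtain t where t: "-pi \<le> t" "t \<le> 0" "f (t + pi) = f t" by auto
  define g where "g x = f x - f t" for x
  have g: "(g has_real_derivative f' x) (at x within {-pi..pi})" if "x \<in> {-pi..pi}" for x
    unfolding g_def using f[OF that] by (auto intro!: derivative_eq_intros)
  have gc: "continuous_on {-pi..pi} g" unfolding g_def by (intro continuous_intros fc)
  have split: "integral {-pi..pi} h = integral {-pi..t} h + integral {t..t+pi} h + integral {t+pi..pi} h"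
    if "continuous_on {-pi..pi} h" for h :: "real \<Rightarrow> real"
  proof -
    have "integral {-pi..t} h + integral {t..pi} h = integral {-pi..pi} h"
      using t by (intro Henstock_Kurzweil_Integration.integral_combine integrable_continuous_real that) auto
    moreover have "integral {t..t+pi} h + integral {t+pi..pi} h = integral {t..pi} h"
      using t by (intro Henstock_Kurzweil_Integration.integral_combine integrable_continuous_real continuous_on_subset[OF that]) auto
    ultimately show ?thesis by simp
  qed
  have c: "c\<^sup>2 * integral {-pi..pi} (\<lambda>x. (g x)\<^sup>2) \<le> integral {-pi..pi} (\<lambda>x. (f' x)\<^sup>2)"
    if c: "0 < c" "c < 1" for c
  proof -
    have ineq: "c\<^sup>2 * integral {a..b} (\<lambda>x. (g x)\<^sup>2) \<le> integral {a..b} (\<lambda>x. (f' x)\<^sup>2)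
      + (c * tan (c * (b - m)) * (g b)\<^sup>2 - c * tan (c * (a - m)) * (g a)\<^sup>2)"
      if "m - pi/2 \<le> a" "a \<le> b" "b \<le> m + pi/2" "-pi \<le> a" "b \<le> pi" for a b m
      using that by (intro tan_weight_inequality c continuous_on_subset[OF f'] DERIV_subset[OF g]) auto
    have z: "g t = 0" "g (t + pi) = 0" "g (-pi) = g pi" using t periodic by (auto simp: g_def)
    \<comment> \<open>The half circle from \<open>t + pi\<close> to \<open>t\<close> crosses the cut
      at \<open>pi\<close> and is treated as two intervals whose centres differ by
      \<open>2 * pi\<close>. The weights agree at the cut, so the boundary terms there
      cancel.\<close>
    have seam: "-pi - (t - pi/2) = pi - (t + 3*pi/2)" by simp
    show ?thesis
      using ineq[of "t - pi/2" "-pi" t] ineq[of "t + pi/2" t "t + pi"] ineq[of "t + 3*pi/2" "t + pi" pi] t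
      unfolding z seam
      by (simp add: split continuous_on_power gc f' distrib_left)
  qed
  have "((\<lambda>c. c\<^sup>2 * integral {-pi..pi} (\<lambda>x. (g x)\<^sup>2)) \<longlongrightarrow> 1\<^sup>2 * integral {-pi..pi} (\<lambda>x. (g x)\<^sup>2)) (at_left 1)"
    by (intro tendsto_intros)
  moreover have "\<forall>\<^sub>F c in at_left (1::real). 0 < c \<and> c < 1"
    by (simp add: eventually_at_left_field) (metis zero_less_one)
  then have "\<forall>\<^sub>F c in at_left 1. c\<^sup>2 * integral {-pi..pi} (\<lambda>x. (g x)\<^sup>2) \<le> integral {-pi..pi} (\<lambda>x. (f' x)\<^sup>2)"
    by (rule eventually_mono) (use c in auto)
  ultimately have "1\<^sup>2 * integral {-pi..pi} (\<lambda>x. (g x)\<^sup>2) \<le> integral {-pi..pi} (\<lambda>x. (f' x)\<^sup>2)"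
    by (rule tendsto_upperbound) simp
  \<comment> \<open>The mean-zero condition removes the cross term of the square.\<close>
  moreover have "integral {-pi..pi} (\<lambda>x. (g x)\<^sup>2) = integral {-pi..pi} (\<lambda>x. (f x)\<^sup>2) + 2 * pi * (f t)\<^sup>2"
  proof -
    have "((\<lambda>x. (f t)\<^sup>2) has_integral 2 * pi * (f t)\<^sup>2) {-pi..pi}"
      using has_integral_const_real[of "(f t)\<^sup>2" "-pi" pi] by simp
    then have "((\<lambda>x. (f x)\<^sup>2 - 2 * f t * f x + (f t)\<^sup>2) has_integral
        (integral {-pi..pi} (\<lambda>x. (f x)\<^sup>2) - 2 * f t * integral {-pi..pi} f
         + 2 * pi * (f t)\<^sup>2)) {-pi..pi}"
      by (intro has_integral_add has_integral_diff has_integral_mult_right integrable_integral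
          integrable_continuous_real continuous_intros fc)
    then show ?thesis
      unfolding g_def mean by (intro integral_unique) (simp add: power2_diff algebra_simps)
  qed
  moreover have "0 \<le> 2 * pi * (f t)\<^sup>2" by simp
  ultimately show ?thesis unfolding power_one mult_1 by linarith
qed

text \<open>In the notation of the proof, the right-hand side is
  \<open>(1 - \<mu>\<^sup>2) * (C - B) + \<mu>\<^sup>2 * G\<close>. The first summand is merely
  estimated from below by zero; the coercivity, and with it the factor \<open>\<mu>\<^sup>2\<close>,
  comes from \<open>G\<close>.\<close>

lemma second_variation_coercive:
  fixes f f1 f2 :: "real \<Rightarrow> real" and \<mu> :: real
  assumes \<mu>: "0 \<le> \<mu>" "\<mu> \<le> 1"
    and f: "\<And>x. x \<in> {-pi..pi} \<Longrightarrow> (f has_real_derivative f1 x) (at x within {-pi..pi})"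
    and f1: "\<And>x. x \<in> {-pi..pi} \<Longrightarrow> (f1 has_real_derivative f2 x) (at x within {-pi..pi})"
    and f2: "continuous_on {-pi..pi} f2"
    and clamped: "f (-pi) = 0" "f pi = 0" "f1 (-pi) = 0" "f1 pi = 0"
  shows "\<mu>\<^sup>2 / (2 + 12 * exp (2 * pi)) * integral {-pi..pi} (\<lambda>x. (f x)\<^sup>2 + (f1 x)\<^sup>2 + (f2 x)\<^sup>2)
    \<le> integral {-pi..pi} (\<lambda>x. (f2 x)\<^sup>2 - (1 + \<mu>\<^sup>2) * (f1 x)\<^sup>2 + \<mu>\<^sup>2 * (f x)\<^sup>2)"
proof -
  define I where "I h = integral {-pi..pi} h" for h :: "real \<Rightarrow> real"
  have fc: "continuous_on {-pi..pi} f" and f1c: "continuous_on {-pi..pi} f1"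
    using f f1 by (meson DERIV_continuous_on)+
  note cont = continuous_intros fc f1c f2
  have FTC: "I h' = h pi - h (-pi)"
    if "\<And>x. x \<in> {-pi..pi} \<Longrightarrow> (h has_real_derivative h' x) (at x within {-pi..pi})" for h h'
    unfolding I_def using that
    by (intro integral_unique fundamental_theorem_of_calculus)
      (auto simp: has_real_derivative_iff_has_vector_derivative)
  have I: "(h has_integral I h) {-pi..pi}" if "continuous_on {-pi..pi} h" for h
    unfolding I_def by (intro integrable_integral integrable_continuous_real that)
  define g where "g x = f2 x + f x" for x
  have gc: "continuous_on {-pi..pi} g" unfolding g_def by (intro cont)
  note cont = cont gc
  define A B C G where "A = I (\<lambda>x. (f x)\<^sup>2)" and "B = I (\<lambda>x. (f1 x)\<^sup>2)"
    and "C = I (\<lambda>x. (f2 x)\<^sup>2)" and "G = I (\<lambda>x. (g x)\<^sup>2)"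
  \<comment> \<open>Wirtinger's inequality is applied to \<open>f1\<close>, whose mean vanishes
    because \<open>f\<close> has equal end values.\<close>
  have BC: "B \<le> C"
    unfolding B_def C_def I_def
    by (rule wirtinger_periodic) (use f1 f2 clamped FTC[OF f] in \<open>auto simp: I_def\<close>)
  have lin: "I (\<lambda>x. (f2 x)\<^sup>2 + p * (f1 x)\<^sup>2 + q * (f x)\<^sup>2) = C + p * B + q * A" for p q
    unfolding I_def[of "\<lambda>x. (f2 x)\<^sup>2 + p * (f1 x)\<^sup>2 + q * (f x)\<^sup>2"] A_def B_def C_def
    by (intro integral_unique has_integral_add has_integral_mult_right I cont)
  have by_parts: "I (\<lambda>x. (f1 x)\<^sup>2 + f x * f2 x) = 0"
  proof -
    have "((\<lambda>x. f x * f1 x) has_real_derivative (f1 x)\<^sup>2 + f x * f2 x) (at x within {-pi..pi})"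
      if "x \<in> {-pi..pi}" for x
      by (rule derivative_eq_intros f[OF that] f1[OF that] refl)+ (simp add: power2_eq_square)
    from FTC[OF this] clamped show ?thesis by simp
  qed
  \<comment> \<open>By parts, the integral of \<open>f * f2\<close> is \<open>- B\<close>; twice
    this relation is added to the sum of squares.\<close>
  have G: "G = C - 2 * B + A"
  proof -
    have "((\<lambda>x. (f2 x)\<^sup>2 + (-2) * (f1 x)\<^sup>2 + 1 * (f x)\<^sup>2 + 2 * ((f1 x)\<^sup>2 + f x * f2 x))
        has_integral (C + (-2) * B + 1 * A + 2 * 0)) {-pi..pi}"
      unfolding by_parts[symmetric] lin[symmetric]
      by (intro has_integral_add has_integral_mult_right I cont)
    then show ?thesis
      unfolding G_def g_def I_def by (intro integral_unique) (simp add: power2_sum algebra_simps)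
  qed
  have AB: "A + B \<le> 4 * exp (2*pi) * G"
  proof -
    \<comment> \<open>Integrate the derivative of \<open>exp (-x) (f\<^sup>2 + f'\<^sup>2)\<close>, which vanishes at both ends.\<close>
    have "((\<lambda>x. exp (-x) * ((f x)\<^sup>2 + (f1 x)\<^sup>2)) has_real_derivative
        exp (-x) * (2 * f1 x * g x - ((f x)\<^sup>2 + (f1 x)\<^sup>2))) (at x within {-pi..pi})"
      if "x \<in> {-pi..pi}" for x
      by (rule derivative_eq_intros f[OF that] f1[OF that] refl | simp)+
        (simp add: g_def power2_eq_square algebra_simps)
    from FTC[OF this] have Z: "I (\<lambda>x. exp (-x) * (2 * f1 x * g x - ((f x)\<^sup>2 + (f1 x)\<^sup>2))) = 0"
      using clamped by simp
    have "exp (-pi) * (1/2) * (A + B) = I (\<lambda>x. exp (-pi) * (1/2) * ((f x)\<^sup>2 + (f1 x)\<^sup>2))"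
      unfolding I_def[of "\<lambda>x. exp (-pi) * (1/2) * ((f x)\<^sup>2 + (f1 x)\<^sup>2)"] A_def B_def
      by (intro integral_unique[symmetric] has_integral_add has_integral_mult_right I cont)
    also have "\<dots> \<le> I (\<lambda>x. exp pi * 2 * (g x)\<^sup>2
        - exp (-x) * (2 * f1 x * g x - ((f x)\<^sup>2 + (f1 x)\<^sup>2)))"
      unfolding I_def
    proof (intro integral_le integrable_continuous_real cont)
      fix x assume x: "x \<in> {-pi..pi}"
      \<comment> \<open>Young's inequality is weighted so that half of the energy
        \<open>(f x)\<^sup>2 + (f1 x)\<^sup>2\<close> remains available for the lower bound.\<close>
      have "2 * f1 x * g x \<le> 1/2 * (f1 x)\<^sup>2 + 2 * (g x)\<^sup>2"
        using zero_le_power2[of "f1 x - 2 * g x"] by (simp add: power2_eq_square algebra_simps)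
      also have "\<dots> \<le> 1/2 * ((f x)\<^sup>2 + (f1 x)\<^sup>2) + 2 * (g x)\<^sup>2" by simp
      finally have "2 * f1 x * g x \<le> 1/2 * ((f x)\<^sup>2 + (f1 x)\<^sup>2) + 2 * (g x)\<^sup>2" .
      then have "exp (-x) * (2 * f1 x * g x) \<le> exp (-x) * (1/2 * ((f x)\<^sup>2 + (f1 x)\<^sup>2) + 2 * (g x)\<^sup>2)"
        by (intro mult_left_mono) auto
      moreover have "exp (-pi) * (1/2 * ((f x)\<^sup>2 + (f1 x)\<^sup>2)) \<le> exp (-x) * (1/2 * ((f x)\<^sup>2 + (f1 x)\<^sup>2))"
        using x by (intro mult_right_mono) auto
      moreover have "exp (-x) * (2 * (g x)\<^sup>2) \<le> exp pi * (2 * (g x)\<^sup>2)"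
        using x by (intro mult_right_mono) auto
      ultimately show "exp (-pi) * (1/2) * ((f x)\<^sup>2 + (f1 x)\<^sup>2) \<le> exp pi * 2 * (g x)\<^sup>2
        - exp (-x) * (2 * f1 x * g x - ((f x)\<^sup>2 + (f1 x)\<^sup>2))"
        by (simp add: algebra_simps)
    qed
    also have "\<dots> = exp pi * 2 * G - 0"
      unfolding I_def[of "\<lambda>x. exp pi * 2 * (g x)\<^sup>2 - _ x"] G_def Z[symmetric]
      by (intro integral_unique has_integral_diff has_integral_mult_right I cont)
    finally have "exp pi * (exp (-pi) * (1/2) * (A + B)) \<le> exp pi * (exp pi * 2 * G)"
      by (intro mult_left_mono) auto
    moreover have "exp pi * (exp (-pi) * (1/2) * (A + B)) = (A + B) / 2"
      by (simp add: exp_minus)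
    moreover have "exp pi * (exp pi * 2 * G) = 2 * exp (2*pi) * G"
      unfolding exp_double power2_eq_square by simp
    ultimately have "(A + B) / 2 \<le> 2 * exp (2*pi) * G" by (simp only:)
    then show ?thesis by simp
  qed
  \<comment> \<open>For a non-integrable square the integral has the default value 0.\<close>
  have nn: "0 \<le> I (\<lambda>x. (h x)\<^sup>2)" for h
    unfolding I_def
    by (cases "(\<lambda>x. (h x)\<^sup>2) integrable_on {-pi..pi}")
      (auto intro: integral_nonneg simp: not_integrable_integral)
  have "A \<ge> 0" "B \<ge> 0" "G \<ge> 0" unfolding A_def B_def G_def by (rule nn)+
  have ABC: "A + B + C \<le> (2 + 12 * exp (2*pi)) * G"
  proof -
    \<comment> \<open>Eliminating \<open>C\<close> through \<open>G\<close> leaves only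
      \<open>B\<close> to be bounded; the constant \<open>2 + 12 * exp (2 * pi)\<close> results from
      \<open>AB\<close>.\<close>
    have "A + B + C = G + 3 * B" using G by simp
    also have "\<dots> \<le> 2 * G + 3 * (A + B)" using \<open>A \<ge> 0\<close> \<open>G \<ge> 0\<close> by simp
    also have "\<dots> \<le> 2 * G + 3 * (4 * exp (2*pi) * G)" using AB by simp
    also have "\<dots> = (2 + 12 * exp (2*pi)) * G" by (simp add: algebra_simps)
    finally show ?thesis .
  qed
  have "\<mu>\<^sup>2 / (2 + 12 * exp (2*pi)) * (A + B + C) \<le> \<mu>\<^sup>2 * G"
  proof -
    have "(A + B + C) / (2 + 12 * exp (2*pi)) \<le> G"
      using ABC by (simp add: divide_le_eq add_pos_pos mult.commute)
    then have "\<mu>\<^sup>2 * ((A + B + C) / (2 + 12 * exp (2*pi))) \<le> \<mu>\<^sup>2 * G"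
      by (intro mult_left_mono) auto
    then show ?thesis by simp
  qed
  also have "\<dots> \<le> \<mu>\<^sup>2 * G + (1 - \<mu>\<^sup>2) * (C - B)"
    using BC \<mu> by (simp add: power_le_one)
  also have "\<dots> = C - (1 + \<mu>\<^sup>2) * B + \<mu>\<^sup>2 * A"
    unfolding G by (simp add: algebra_simps)
  finally show ?thesis
    using lin[of "- (1 + \<mu>\<^sup>2)" "\<mu>\<^sup>2"] lin[of 1 1] by (simp add: I_def algebra_simps)
qed

subsection \<open>The critical arc\<close>

text \<open>The unit tangent is \<open>- (cos \<theta>, sin \<theta>)\<close>, the normal is \<open>(- sin \<theta>, cos \<theta>)\<close>, \<open>\<rho>\<close> is the radius
  of curvature and \<open>\<rho>1\<close> its derivative. All of this is smooth on the open set \<open>arc_dom\<close>, which contains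
  the parameter interval.\<close>

locale critical_arc =
  fixes x0 L :: real
  assumes x0_pos: "0 < x0" and L_gt: "3 * x0 < L"
begin

definition \<mu> :: real where "\<mu> = sqrt (x0 / (L + x0))"
abbreviation k :: real where "k \<equiv> kk x0 L"
abbreviation ang :: "real \<Rightarrow> real" where "ang \<equiv> aa x0 L"
abbreviation \<gamma> :: "real \<Rightarrow> real \<times> real" where "\<gamma> \<equiv> gamma_crv x0 L"
definition \<theta> :: "real \<Rightarrow> real" where "\<theta> s = ang s / \<mu>"
definition \<rho> :: "real \<Rightarrow> real" where "\<rho> s = \<mu> * k * cos (ang s)"
definition \<rho>1 :: "real \<Rightarrow> real" where "\<rho>1 s = - \<mu> * tan (ang s)"
definition arc_dom :: "real set" where "arc_dom = {L - k<..<L + k}"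

lemma L_pos: "0 < L"
  using x0_pos L_gt by linarith

lemma \<mu>_sq: "\<mu>\<^sup>2 = x0 / (L + x0)"
  using x0_pos L_pos by (simp add: \<mu>_def)

lemma \<mu>_pos: "0 < \<mu>" and \<mu>_less: "\<mu> < 1/2"
proof -
  show "0 < \<mu>" using x0_pos L_pos by (simp add: \<mu>_def)
  have "\<mu>\<^sup>2 < (1/2)\<^sup>2" using x0_pos L_gt unfolding \<mu>_sq by (simp add: power2_eq_square field_simps)
  then show "\<mu> < 1/2" by (rule power2_less_imp_less) simp
qed

lemma sig_eq: "sig x0 L = pi * \<mu>"
  by (simp add: sig_def \<mu>_def)

lemma sig_pos: "0 < sig x0 L" and sig_less: "sig x0 L < pi/2"
  using \<mu>_pos mult_strict_left_mono[OF \<mu>_less pi_gt_zero] by (auto simp: sig_eq)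

lemma sin_sig_pos: "0 < sin (sig x0 L)" and cos_sig_pos: "0 < cos (sig x0 L)"
  using sig_pos sig_less by (auto intro!: sin_gt_zero cos_gt_zero)

lemma sin_sig_less: "sin (sig x0 L) < 1"
proof -
  have "(sin (sig x0 L))\<^sup>2 < 1\<^sup>2"
    using sin_cos_squared_add[of "sig x0 L"] zero_less_power[OF cos_sig_pos, of 2]
    unfolding power_one by linarith
  then show ?thesis by (rule power2_less_imp_less) simp
qed

lemma L_eq: "L = k * sin (sig x0 L)"
  using sin_sig_pos by (simp add: kk_def)

lemma L_less: "L < k"
  using L_pos sin_sig_pos sin_sig_less unfolding kk_def by (simp add: field_simps)

lemma k_pos: "0 < k"
  using L_less L_pos by linarith

lemma interval_dom: "{0..2*L} \<subseteq> arc_dom"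
  using L_less by (auto simp: arc_dom_def)

lemma open_dom: "open arc_dom"
  by (simp add: arc_dom_def)

lemma dom_abs: "s \<in> arc_dom \<Longrightarrow> -1 < (s - L) / k \<and> (s - L) / k < 1"
  using k_pos by (auto simp: arc_dom_def field_simps)

lemma k_sin_ang: "s \<in> arc_dom \<Longrightarrow> k * sin (ang s) = s - L"
  using dom_abs[of s] k_pos by (simp add: aa_def sin_arcsin)

lemma cos_ang_pos: "s \<in> arc_dom \<Longrightarrow> 0 < cos (ang s)"
  using dom_abs[of s] unfolding aa_def by (intro cos_gt_zero_pi arcsin_lt_bounded[THEN conjunct1] arcsin_lt_bounded[THEN conjunct2]) auto

lemma \<rho>_pos: "s \<in> arc_dom \<Longrightarrow> 0 < \<rho> s"
  using cos_ang_pos \<mu>_pos k_pos by (simp add: \<rho>_def)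

lemma ang_deriv:
  assumes "s \<in> arc_dom"
  shows "(ang has_real_derivative \<mu> / \<rho> s) (at s within S)"
proof -
  have "cos (ang s) = sqrt (1 - ((s - L) / k)\<^sup>2)"
    using dom_abs[OF assms] by (simp add: aa_def cos_arcsin)
  moreover have "(ang has_real_derivative inverse (sqrt (1 - ((s - L) / k)\<^sup>2)) * (1 / k)) (at s within S)"
    unfolding aa_def
    by (rule DERIV_chain2[OF DERIV_arcsin]) (use dom_abs[OF assms] k_pos in \<open>auto intro!: derivative_eq_intros\<close>)
  ultimately show ?thesis
    using \<mu>_pos k_pos by (simp add: \<rho>_def divide_simps mult.commute)
qed

lemma \<theta>_deriv: "s \<in> arc_dom \<Longrightarrow> (\<theta> has_real_derivative 1 / \<rho> s) (at s within S)"
  unfolding \<theta>_def using \<mu>_pos by (auto intro!: derivative_eq_intros ang_deriv)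

lemma \<rho>_deriv:
  assumes "s \<in> arc_dom" shows "(\<rho> has_real_derivative \<rho>1 s) (at s within S)"
  unfolding \<rho>_def[abs_def]
  by (rule derivative_eq_intros ang_deriv[OF assms] refl)+
    (use \<mu>_pos k_pos cos_ang_pos[OF assms] in \<open>simp add: \<rho>1_def \<rho>_def tan_def\<close>)

text \<open>This is half the derivative of \<open>\<rho>\<^sup>2\<close>, that is, the Euler
  equation integrated once.\<close>

lemma \<rho>_\<rho>1: "s \<in> arc_dom \<Longrightarrow> \<rho> s * \<rho>1 s = - \<mu>\<^sup>2 * (s - L)"
  using cos_ang_pos[of s] k_sin_ang[of s, symmetric] by (simp add: \<rho>_def \<rho>1_def tan_def power2_eq_square)

lemma \<rho>1_deriv:
  assumes "s \<in> arc_dom"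
  shows "(\<rho>1 has_real_derivative - (\<mu>\<^sup>2 + (\<rho>1 s)\<^sup>2) / \<rho> s) (at s within S)"
proof -
  have cos: "cos (ang s) \<noteq> 0" using cos_ang_pos[OF assms] by simp
  have "(\<rho>1 has_real_derivative - \<mu> * (inverse ((cos (ang s))\<^sup>2) * (\<mu> / \<rho> s))) (at s within S)"
    unfolding \<rho>1_def[abs_def]
    by (intro DERIV_cmult DERIV_chain2[of tan] DERIV_tan cos ang_deriv assms)
  moreover have "inverse ((cos (ang s))\<^sup>2) = 1 + (tan (ang s))\<^sup>2"
    using tan_sec[OF cos] by (simp add: power_inverse)
  ultimately show ?thesis
    by (simp add: \<rho>1_def power2_eq_square algebra_simps add_divide_distrib diff_divide_distrib)
qed

lemma \<theta>_cont: "S \<subseteq> arc_dom \<Longrightarrow> continuous_on S \<theta>"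
  by (rule DERIV_continuous_on[OF \<theta>_deriv]) auto

lemma \<rho>_cont: "S \<subseteq> arc_dom \<Longrightarrow> continuous_on S \<rho>"
  by (rule DERIV_continuous_on[OF \<rho>_deriv]) auto

lemma \<rho>1_cont: "S \<subseteq> arc_dom \<Longrightarrow> continuous_on S \<rho>1"
  by (rule DERIV_continuous_on[OF \<rho>1_deriv]) auto

section \<open>The two harmonics of the curve and its moving frame\<close>

definition \<alpha> :: real where "\<alpha> = 1 / \<mu> + 1"
definition \<beta> :: real where "\<beta> = 1 / \<mu> - 1"
definition y0 :: real where "y0 = pi * x0 / (sig x0 L * tan (sig x0 L))"

lemma \<alpha>_pos: "0 < \<alpha>" and \<beta>_pos: "0 < \<beta>"
  using \<mu>_pos \<mu>_less by (auto simp: \<alpha>_def \<beta>_def field_simps)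

lemma frequencies: "(pi + sig x0 L) / sig x0 L = \<alpha>" "(pi - sig x0 L) / sig x0 L = \<beta>"
  unfolding sig_eq \<alpha>_def \<beta>_def using \<mu>_pos by (simp_all add: field_simps)

lemma amplitudes: "sig x0 L / (pi + sig x0 L) = 1 / \<alpha>" "sig x0 L / (pi - sig x0 L) = 1 / \<beta>"
  unfolding frequencies[symmetric] by simp_all

lemma \<alpha>_ang: "\<alpha> * ang s = \<theta> s + ang s" and \<beta>_ang: "\<beta> * ang s = \<theta> s - ang s"
  by (simp_all add: \<alpha>_def \<beta>_def \<theta>_def algebra_simps)

lemma \<gamma>_fst: "fst (\<gamma> s) = - k / 2 * (sin (\<alpha> * ang s) / \<alpha> + sin (\<beta> * ang s) / \<beta>)"
  and \<gamma>_snd: "snd (\<gamma> s) = k / 2 * (cos (\<alpha> * ang s) / \<alpha> + cos (\<beta> * ang s) / \<beta>) + y0"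
  unfolding gamma_crv_def Let_def frequencies amplitudes y0_def by simp_all

lemma sin_ang_deriv:
  assumes "s \<in> arc_dom" "c \<noteq> 0"
  shows "((\<lambda>s. sin (c * ang s) / c) has_real_derivative cos (c * ang s) * (\<mu> / \<rho> s)) (at s within S)"
  by (rule derivative_eq_intros ang_deriv[OF assms(1)] refl assms(2))+ (simp add: assms(2))

lemma cos_ang_deriv:
  assumes "s \<in> arc_dom" "c \<noteq> 0"
  shows "((\<lambda>s. cos (c * ang s) / c) has_real_derivative - sin (c * ang s) * (\<mu> / \<rho> s)) (at s within S)"
  by (rule derivative_eq_intros ang_deriv[OF assms(1)] refl assms(2))+ (simp add: assms(2))

lemma \<rho>_ang: "s \<in> arc_dom \<Longrightarrow> k * cos (ang s) * (\<mu> / \<rho> s) = 1"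
  using cos_ang_pos[of s] k_pos \<mu>_pos by (simp add: \<rho>_def)

text \<open>The frequencies make the two phases \<open>\<theta> s + ang s\<close> and
  \<open>\<theta> s - ang s\<close>. The addition theorem factors \<open>cos (ang s)\<close> out of
  the sum, and this factor cancels against the derivative of \<open>ang\<close>.\<close>

lemma \<gamma>_fst_deriv:
  assumes "s \<in> arc_dom" shows "((\<lambda>s. fst (\<gamma> s)) has_real_derivative - cos (\<theta> s)) (at s within S)"
proof -
  have "((\<lambda>s. fst (\<gamma> s)) has_real_derivative
      - k / 2 * (cos (\<alpha> * ang s) * (\<mu> / \<rho> s) + cos (\<beta> * ang s) * (\<mu> / \<rho> s))) (at s within S)"
    unfolding \<gamma>_fst using \<alpha>_pos \<beta>_pos
    by (intro DERIV_cmult DERIV_add sin_ang_deriv assms) auto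
  moreover have "- k / 2 * (cos (\<alpha> * ang s) * (\<mu> / \<rho> s) + cos (\<beta> * ang s) * (\<mu> / \<rho> s))
      = - cos (\<theta> s) * (k * cos (ang s) * (\<mu> / \<rho> s))"
    unfolding \<alpha>_ang \<beta>_ang cos_add cos_diff by (simp add: algebra_simps)
  ultimately show ?thesis unfolding \<rho>_ang[OF assms] by (simp only: mult_1_right)
qed

lemma \<gamma>_snd_deriv:
  assumes "s \<in> arc_dom" shows "((\<lambda>s. snd (\<gamma> s)) has_real_derivative - sin (\<theta> s)) (at s within S)"
proof -
  have "((\<lambda>s. snd (\<gamma> s)) has_real_derivative
      k / 2 * (- sin (\<alpha> * ang s) * (\<mu> / \<rho> s) + - sin (\<beta> * ang s) * (\<mu> / \<rho> s)) + 0) (at s within S)"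
    unfolding \<gamma>_snd using \<alpha>_pos \<beta>_pos
    by (intro DERIV_cmult DERIV_add DERIV_const cos_ang_deriv assms) auto
  moreover have "k / 2 * (- sin (\<alpha> * ang s) * (\<mu> / \<rho> s) + - sin (\<beta> * ang s) * (\<mu> / \<rho> s)) + 0
      = - sin (\<theta> s) * (k * cos (ang s) * (\<mu> / \<rho> s))"
    unfolding \<alpha>_ang \<beta>_ang sin_add sin_diff by (simp add: algebra_simps)
  ultimately show ?thesis unfolding \<rho>_ang[OF assms] by (simp only: mult_1_right)
qed

lemma \<gamma>_d1: "s \<in> arc_dom \<Longrightarrow> crv_d1 \<gamma> s = (- cos (\<theta> s), - sin (\<theta> s))"
  unfolding crv_d1_def using \<gamma>_fst_deriv[of s UNIV] \<gamma>_snd_deriv[of s UNIV]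
  by (intro arg_cong2[of _ _ _ _ Pair] DERIV_imp_deriv)

text \<open>Components of the position vector along the normal and along the negative unit tangent.
  For the unperturbed arc \<open>support\<close> is also the integrand of twice the area.\<close>

definition support :: "real \<Rightarrow> real" where
  "support s = snd (\<gamma> s) * cos (\<theta> s) - fst (\<gamma> s) * sin (\<theta> s)"
definition tangential :: "real \<Rightarrow> real" where
  "tangential s = fst (\<gamma> s) * cos (\<theta> s) + snd (\<gamma> s) * sin (\<theta> s)"

text \<open>This allows the linear part of the area density to be split off as an exact derivative
  in \<open>boundary\<close>.\<close>

lemma tangential_deriv:
  assumes "s \<in> arc_dom"
  shows "(tangential has_real_derivative support s / \<rho> s - 1) (at s within S)"
proof -
  have "cos (\<theta> s) * cos (\<theta> s) + sin (\<theta> s) * sin (\<theta> s) = 1"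
    using sin_cos_squared_add2[of "\<theta> s"] by (simp add: power2_eq_square)
  then have "- cos (\<theta> s) * cos (\<theta> s) + fst (\<gamma> s) * (- sin (\<theta> s) * (1 / \<rho> s))
      + (- sin (\<theta> s) * sin (\<theta> s) + snd (\<gamma> s) * (cos (\<theta> s) * (1 / \<rho> s)))
      = support s * (1 / \<rho> s) - 1"
    unfolding support_def by algebra
  then show ?thesis
    unfolding tangential_def[abs_def]
    by (auto intro!: derivative_eq_intros \<gamma>_fst_deriv \<gamma>_snd_deriv \<theta>_deriv assms simp: algebra_simps)
qed

lemma support_cont:
  assumes "S \<subseteq> arc_dom" shows "continuous_on S support"
proof -
  have "continuous_on S (\<lambda>s. fst (\<gamma> s))" "continuous_on S (\<lambda>s. snd (\<gamma> s))"
    using assms by (auto intro!: DERIV_continuous_on \<gamma>_fst_deriv \<gamma>_snd_deriv)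
  then show ?thesis
    unfolding support_def[abs_def]
    by (intro continuous_on_diff continuous_on_mult continuous_on_cos continuous_on_sin \<theta>_cont assms)
qed

lemma tangential_cont: "S \<subseteq> arc_dom \<Longrightarrow> continuous_on S tangential"
  by (rule DERIV_continuous_on[OF tangential_deriv]) auto

end

text \<open>The outer \<open>deriv\<close> sees \<open>deriv f\<close> in a neighbourhood of
  \<open>s\<close>, so the first derivative has to be known on an open set and not only at
  \<open>s\<close>.\<close>

lemma deriv_deriv_eq:
  fixes f f1 :: "real \<Rightarrow> real"
  assumes "open S" "s \<in> S" and f: "\<And>t. t \<in> S \<Longrightarrow> (f has_real_derivative f1 t) (at t)"
    and f1: "(f1 has_real_derivative d) (at s)"
  shows "deriv (deriv f) s = d"
proof -
  have "\<forall>\<^sub>F t in nhds s. deriv f t = f1 t"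
    using assms by (auto simp: eventually_nhds intro!: exI[of _ S] DERIV_imp_deriv)
  then show ?thesis
    using DERIV_imp_deriv[OF f1] deriv_cong_ev by metis
qed

subsection \<open>Normal perturbations\<close>

text \<open>Derivatives are taken within the closed interval, so \<open>\<phi>\<close> is arbitrary
  outside it. Statements about \<open>deriv\<close> of the perturbed curve are therefore made at
  interior points.\<close>

locale perturbed_arc = critical_arc +
  fixes \<phi> \<phi>1 \<phi>2 :: "real \<Rightarrow> real"
  assumes \<phi>: "\<And>s. s \<in> {0..2*L} \<Longrightarrow> (\<phi> has_real_derivative \<phi>1 s) (at s within {0..2*L})"
    and \<phi>1: "\<And>s. s \<in> {0..2*L} \<Longrightarrow> (\<phi>1 has_real_derivative \<phi>2 s) (at s within {0..2*L})"
    and \<phi>2_cont: "continuous_on {0..2*L} \<phi>2"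
begin

text \<open>The velocity has components \<open>w\<close>, \<open>\<phi>1\<close> in the moving frame; \<open>scaled_curv\<close> is \<open>\<rho>\<close> times the
  denominator in \<open>FF\<close>.\<close>

definition w :: "real \<Rightarrow> real" where "w s = 1 + \<phi> s / \<rho> s"
definition w1 :: "real \<Rightarrow> real" where "w1 s = (\<phi>1 s - \<rho>1 s * \<phi> s / \<rho> s) / \<rho> s"
definition speed2 :: "real \<Rightarrow> real" where "speed2 s = (w s)\<^sup>2 + (\<phi>1 s)\<^sup>2"
definition scaled_curv :: "real \<Rightarrow> real" where
  "scaled_curv s = (w s)\<^sup>2 - w s * (\<rho> s * \<phi>2 s) + 2 * (\<phi>1 s)\<^sup>2 - \<rho>1 s * (\<phi> s / \<rho> s) * \<phi>1 s"
definition area_density :: "real \<Rightarrow> real" where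
  "area_density s = w s * support s + \<phi>1 s * tangential s + \<phi> s * w s"

lemma \<phi>_cont: "continuous_on {0..2*L} \<phi>" and \<phi>1_cont: "continuous_on {0..2*L} \<phi>1"
  by (rule DERIV_continuous_on[OF \<phi>] DERIV_continuous_on[OF \<phi>1], assumption)+

lemmas arc_cont = \<phi>_cont \<phi>1_cont \<phi>2_cont \<rho>_cont[OF interval_dom] \<rho>1_cont[OF interval_dom]
  support_cont[OF interval_dom] tangential_cont[OF interval_dom]

lemma \<rho>_nz: "s \<in> {0..2*L} \<Longrightarrow> \<rho> s \<noteq> 0"
  using \<rho>_pos interval_dom by force

lemma density_cont: "continuous_on {0..2*L} w" "continuous_on {0..2*L} speed2"
  "continuous_on {0..2*L} scaled_curv" "continuous_on {0..2*L} area_density"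
  unfolding speed2_def scaled_curv_def area_density_def w_def
  using \<rho>_nz by (auto intro!: continuous_intros arc_cont)

lemma perturb_eq:
  assumes "s \<in> arc_dom"
  shows "fst (perturb \<gamma> \<phi> s) = fst (\<gamma> s) - \<phi> s * sin (\<theta> s)"
    and "snd (perturb \<gamma> \<phi> s) = snd (\<gamma> s) + \<phi> s * cos (\<theta> s)"
  by (simp_all add: perturb_def \<gamma>_d1[OF assms] perp_def)

context
  fixes s :: real assumes s: "s \<in> {0<..<2*L}"
begin

lemma s_dom: "s \<in> arc_dom" and \<rho>_nz': "\<rho> s \<noteq> 0"
  using s interval_dom \<rho>_nz[of s] by (auto simp: subset_iff)

lemma \<phi>_at: "(\<phi> has_real_derivative \<phi>1 s) (at s)"
  and \<phi>1_at: "(\<phi>1 has_real_derivative \<phi>2 s) (at s)"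
  using \<phi>[of s] \<phi>1[of s] s by (auto simp: at_within_Icc_at)

lemma w_at: "(w has_real_derivative w1 s) (at s)"
  unfolding w_def[abs_def] w1_def
  by (rule derivative_eq_intros \<phi>_at \<rho>_deriv s_dom \<rho>_nz' refl)+ (use \<rho>_nz' in \<open>simp add: field_simps\<close>)

lemma fst_perturb_at: "((\<lambda>s. fst (perturb \<gamma> \<phi> s)) has_real_derivative
    - w s * cos (\<theta> s) - \<phi>1 s * sin (\<theta> s)) (at s)"
proof -
  have "((\<lambda>s. fst (\<gamma> s) - \<phi> s * sin (\<theta> s)) has_real_derivative - w s * cos (\<theta> s) - \<phi>1 s * sin (\<theta> s)) (at s)"
    by (rule derivative_eq_intros \<phi>_at \<theta>_deriv \<gamma>_fst_deriv s_dom refl)+ (simp add: w_def algebra_simps)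
  then show ?thesis
    by (rule has_field_derivative_transform_within_open[OF _ open_dom s_dom]) (simp add: perturb_eq)
qed

lemma snd_perturb_at: "((\<lambda>s. snd (perturb \<gamma> \<phi> s)) has_real_derivative
    - w s * sin (\<theta> s) + \<phi>1 s * cos (\<theta> s)) (at s)"
proof -
  have "((\<lambda>s. snd (\<gamma> s) + \<phi> s * cos (\<theta> s)) has_real_derivative - w s * sin (\<theta> s) + \<phi>1 s * cos (\<theta> s)) (at s)"
    by (rule derivative_eq_intros \<phi>_at \<theta>_deriv \<gamma>_snd_deriv s_dom refl)+ (simp add: w_def algebra_simps)
  then show ?thesis
    by (rule has_field_derivative_transform_within_open[OF _ open_dom s_dom]) (simp add: perturb_eq)
qed

lemma fst_perturb_at2: "((\<lambda>s. - w s * cos (\<theta> s) - \<phi>1 s * sin (\<theta> s)) has_real_derivative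
    - w1 s * cos (\<theta> s) + w s * sin (\<theta> s) / \<rho> s - \<phi>2 s * sin (\<theta> s) - \<phi>1 s * cos (\<theta> s) / \<rho> s) (at s)"
  by (rule derivative_eq_intros w_at \<phi>1_at \<theta>_deriv s_dom refl)+ (simp add: algebra_simps)

lemma snd_perturb_at2: "((\<lambda>s. - w s * sin (\<theta> s) + \<phi>1 s * cos (\<theta> s)) has_real_derivative
    - w1 s * sin (\<theta> s) - w s * cos (\<theta> s) / \<rho> s + \<phi>2 s * cos (\<theta> s) - \<phi>1 s * sin (\<theta> s) / \<rho> s) (at s)"
  by (rule derivative_eq_intros w_at \<phi>1_at \<theta>_deriv s_dom refl)+ (simp add: algebra_simps)

end

text \<open>Inner products and determinants of plane vectors are invariant under rotation. In the
  frame turned by \<open>\<theta> s\<close> the trigonometric functions thus enter only through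
  \<open>c * c + S * S\<close>.\<close>

lemma perturb_densities:
  assumes s: "s \<in> {0<..<2*L}"
  defines "\<eta> \<equiv> perturb \<gamma> \<phi>"
  shows "(pinner (crv_d1 \<eta> s) (crv_d1 \<eta> s))\<^sup>2 / pinner (crv_d1 \<eta> s) (perp (crv_d2 \<eta> s))
      = \<rho> s * (speed2 s)\<^sup>2 / scaled_curv s" (is ?F)
    and "fst (\<eta> s) * snd (crv_d1 \<eta> s) - fst (crv_d1 \<eta> s) * snd (\<eta> s) = area_density s" (is ?A)
proof -
  define c S where "c = cos (\<theta> s)" and "S = sin (\<theta> s)"
  have cS: "c * c + S * S = 1"
    using sin_cos_squared_add[of "\<theta> s"] by (simp add: c_def S_def power2_eq_square)
  have d1: "crv_d1 \<eta> s = (- w s * c - \<phi>1 s * S, - w s * S + \<phi>1 s * c)"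
    unfolding crv_d1_def \<eta>_def c_def S_def
    by (intro arg_cong2[of _ _ _ _ Pair] DERIV_imp_deriv fst_perturb_at snd_perturb_at s)
  have d2: "crv_d2 \<eta> s = (- w1 s * c + w s * S * (1 / \<rho> s) - \<phi>2 s * S - \<phi>1 s * c * (1 / \<rho> s),
      - w1 s * S - w s * c * (1 / \<rho> s) + \<phi>2 s * c - \<phi>1 s * S * (1 / \<rho> s))"
    unfolding crv_d2_def \<eta>_def c_def S_def
    using deriv_deriv_eq[OF open_greaterThanLessThan s _ fst_perturb_at2[OF s], OF fst_perturb_at]
      deriv_deriv_eq[OF open_greaterThanLessThan s _ snd_perturb_at2[OF s], OF snd_perturb_at]
    by simp
  have \<rho>: "\<rho> s \<noteq> 0" by (rule \<rho>_nz'[OF s])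
  have sp: "pinner (crv_d1 \<eta> s) (crv_d1 \<eta> s) = speed2 s"
  proof -
    have "pinner (crv_d1 \<eta> s) (crv_d1 \<eta> s) = (c * c + S * S) * speed2 s"
      unfolding d1 pinner_def speed2_def fst_conv snd_conv by (simp add: power2_eq_square algebra_simps)
    then show ?thesis by (simp add: cS)
  qed
  have "pinner (crv_d1 \<eta> s) (perp (crv_d2 \<eta> s))
      = (c * c + S * S) * (w s * w s * (1 / \<rho> s) - w s * \<phi>2 s + \<phi>1 s * w1 s + \<phi>1 s * \<phi>1 s * (1 / \<rho> s))"
    unfolding d1 d2 pinner_def perp_def fst_conv snd_conv by algebra
  also have "\<dots> = w s * w s * (1 / \<rho> s) - w s * \<phi>2 s + \<phi>1 s * w1 s + \<phi>1 s * \<phi>1 s * (1 / \<rho> s)"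
    by (simp only: cS mult_1)
  also have "\<dots> = scaled_curv s / \<rho> s"
    using \<rho> by (simp add: scaled_curv_def w1_def power2_eq_square field_simps)
  finally show ?F using sp by simp
  have "fst (\<eta> s) * snd (crv_d1 \<eta> s) - fst (crv_d1 \<eta> s) * snd (\<eta> s)
      = w s * support s + \<phi>1 s * tangential s + \<phi> s * ((c * c + S * S) * w s)"
    unfolding d1 fst_conv snd_conv unfolding \<eta>_def perturb_eq[OF s_dom[OF s]] support_def
      tangential_def c_def[symmetric] S_def[symmetric] by algebra
  then show ?A by (simp add: area_density_def cS)
qed

text \<open>The two end points, where \<open>deriv\<close> depends on \<open>\<phi>\<close> outside
  the interval, form a null set.\<close>

lemma FF_perturb: "FF L (perturb \<gamma> \<phi>) = integral {0..2*L} (\<lambda>s. \<rho> s * (speed2 s)\<^sup>2 / scaled_curv s)"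
  unfolding FF_def
proof (rule integral_spike[of "{0, 2*L}"])
  fix s assume "s \<in> {0..2*L} - {0, 2*L}"
  then have "s \<in> {0<..<2*L}" by auto
  from perturb_densities(1)[OF this, symmetric]
  show "\<rho> s * (speed2 s)\<^sup>2 / scaled_curv s = (pinner (crv_d1 (perturb \<gamma> \<phi>) s) (crv_d1 (perturb \<gamma> \<phi>) s))\<^sup>2
      / pinner (crv_d1 (perturb \<gamma> \<phi>) s) (perp (crv_d2 (perturb \<gamma> \<phi>) s))" .
qed simp

lemma AA_perturb: "AA L (perturb \<gamma> \<phi>) = 1/2 * integral {0..2*L} area_density"
proof -
  have "integral {0..2*L} (\<lambda>s. fst (perturb \<gamma> \<phi> s) * snd (crv_d1 (perturb \<gamma> \<phi>) s)
      - fst (crv_d1 (perturb \<gamma> \<phi>) s) * snd (perturb \<gamma> \<phi> s)) = integral {0..2*L} area_density"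
  proof (rule integral_spike[of "{0, 2*L}"])
    fix s assume "s \<in> {0..2*L} - {0, 2*L}"
    then have "s \<in> {0<..<2*L}" by auto
    from perturb_densities(2)[OF this, symmetric]
    show "area_density s = fst (perturb \<gamma> \<phi> s) * snd (crv_d1 (perturb \<gamma> \<phi>) s)
      - fst (crv_d1 (perturb \<gamma> \<phi>) s) * snd (perturb \<gamma> \<phi> s)" .
  qed simp
  then show ?thesis by (simp add: AA_def)
qed

end

subsection \<open>Expansion of the functional\<close>

text \<open>The bound \<open>2 * \<tau> * n - \<tau>\<^sup>2 * D\<close> with
  \<open>\<tau> = 1 + v\<close> is a polynomial. Its part of degree at most two is the stated one,
  and the higher terms are estimated by \<open>\<delta>\<close> times the sum of squares.\<close>

lemma quotient_quadratic_lower_bound: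
  fixes u p v e E \<delta> :: real
  assumes small: "\<bar>u\<bar> \<le> \<delta>" "\<bar>p\<bar> \<le> \<delta>" "\<bar>v\<bar> \<le> \<delta>" and e: "\<bar>e\<bar> \<le> E" and \<delta>: "\<delta> * (4 * (1 + E)) \<le> 1"
  defines "w \<equiv> 1 + u"
  defines "D \<equiv> w\<^sup>2 - w * v + 2 * p\<^sup>2 - e * u * p"
  shows "0 < D"
    and "1 + 2 * u + v + u\<^sup>2 + u * v + v\<^sup>2 + e * u * p - 10 * (1 + E) * \<delta> * (u\<^sup>2 + p\<^sup>2 + v\<^sup>2)
      \<le> (w\<^sup>2 + p\<^sup>2)\<^sup>2 / D"
proof -
  have E: "0 \<le> E" and \<delta>0: "0 \<le> \<delta>" using e small by linarith+
  have \<delta>4: "\<delta> \<le> 1/4" and E\<delta>: "E * \<delta> \<le> 1/4"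
  proof -
    have "0 \<le> E * \<delta>" using E \<delta>0 by simp
    moreover have "4 * \<delta> + 4 * (E * \<delta>) \<le> 1" using \<delta> by (simp add: algebra_simps)
    ultimately show "\<delta> \<le> 1/4" "E * \<delta> \<le> 1/4" using \<delta>0 by linarith+
  qed
  have eup: "\<bar>e * u * p\<bar> \<le> 1/16"
  proof -
    have "\<bar>e * u * p\<bar> \<le> E * \<delta> * \<delta>"
      unfolding abs_mult using small e E \<delta>0 by (intro mult_mono) auto
    also have "\<dots> \<le> 1/4 * (1/4)" using E\<delta> \<delta>4 E \<delta>0 by (intro mult_mono) auto
    finally show ?thesis by simp
  qed
  \<comment> \<open>The factors are at least 3/4 and 1/2, so their product outweighs the mixed term,
    which is at most 1/16.\<close>
  have "w * (w - v) \<ge> 3/4 * (1/2)"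
    using small \<delta>4 unfolding w_def by (intro mult_mono) auto
  then have "w\<^sup>2 - w * v \<ge> 3/8" by (simp add: power2_eq_square algebra_simps)
  moreover have "0 \<le> 2 * p\<^sup>2" by simp
  ultimately show D: "0 < D" using eup unfolding D_def by linarith
  define n where "n = w\<^sup>2 + p\<^sup>2"
  define q where "q = u\<^sup>2 + p\<^sup>2 + v\<^sup>2"
  have q: "u\<^sup>2 \<le> q" "p\<^sup>2 \<le> q" "v\<^sup>2 \<le> q" "0 \<le> q" unfolding q_def by auto
  have cross: "\<bar>e * u * p\<bar> \<le> E * q"
  proof -
    have "2 * (\<bar>u\<bar> * \<bar>p\<bar>) \<le> u\<^sup>2 + p\<^sup>2"
      using zero_le_power2[of "\<bar>u\<bar> - \<bar>p\<bar>"] unfolding power2_diff by simp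
    then have "\<bar>u\<bar> * \<bar>p\<bar> \<le> q" using q unfolding q_def by (smt (verit))
    then have "\<bar>e\<bar> * (\<bar>u\<bar> * \<bar>p\<bar>) \<le> E * q" using e E by (intro mult_mono) auto
    then show ?thesis by (simp add: abs_mult mult.assoc)
  qed
  \<comment> \<open>Each remainder term is written as \<open>u\<close> or \<open>v\<close>, of size
    at most \<open>\<delta>\<close>, times a factor bounded by a multiple of
    \<open>q\<close>.\<close>
  have prod: "\<bar>a * b\<bar> \<le> \<delta> * c" if "\<bar>a\<bar> \<le> \<delta>" "\<bar>b\<bar> \<le> c" for a b c :: real
    unfolding abs_mult using that \<delta>0 by (intro mult_mono) auto
  have t1: "\<bar>u * (u * v\<^sup>2)\<bar> \<le> \<delta> * q"
  proof (rule prod[OF small(1)])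
    show "\<bar>u * v\<^sup>2\<bar> \<le> q"
      using mult_mono[of "\<bar>u\<bar>" 1 "v\<^sup>2" q] small q \<delta>4 by (simp add: abs_mult)
  qed
  have t2: "\<bar>v * (2 * p\<^sup>2)\<bar> \<le> \<delta> * (2 * q)"
    by (rule prod[OF small(3)]) (use q in auto)
  have t3: "\<bar>v * (2 * (e * u * p))\<bar> \<le> \<delta> * (2 * (E * q))"
    by (rule prod[OF small(3)]) (use cross in auto)
  have t4: "\<bar>v * ((1 + u) * v\<^sup>2)\<bar> \<le> \<delta> * (2 * q)"
  proof (rule prod[OF small(3)])
    show "\<bar>(1 + u) * v\<^sup>2\<bar> \<le> 2 * q"
      unfolding abs_mult using small q \<delta>4 by (intro mult_mono) auto
  qed
  have t5: "\<bar>v * (v * (2 * p\<^sup>2 - e * u * p))\<bar> \<le> \<delta> * (2 * q + E * q)"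
  proof (rule prod[OF small(3)])
    have "\<bar>2 * p\<^sup>2 - e * u * p\<bar> \<le> 2 * q + E * q" using cross q by (intro order_trans[OF abs_triangle_ineq4] add_mono) auto
    then show "\<bar>v * (2 * p\<^sup>2 - e * u * p)\<bar> \<le> 2 * q + E * q"
      using mult_mono[of "\<bar>v\<bar>" 1 "\<bar>2 * p\<^sup>2 - e * u * p\<bar>" "2 * q + E * q"] small \<delta>4
      by (simp add: abs_mult)
  qed
  \<comment> \<open>The terms after \<open>e * u * p\<close> have degree at least three in
    \<open>u\<close>, \<open>p\<close>, \<open>v\<close>, with \<open>e\<close> as a coefficient;
    they are the ones bounded in \<open>t1\<close> to \<open>t5\<close>.\<close>
  have identity: "2 * (1 + v) * n - (1 + v)\<^sup>2 * D = 1 + 2 * u + v + u\<^sup>2 + u * v + v\<^sup>2 + e * u * p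
      - u * (u * v\<^sup>2) - v * (2 * p\<^sup>2) + v * (2 * (e * u * p)) + v * ((1 + u) * v\<^sup>2)
      - v * (v * (2 * p\<^sup>2 - e * u * p))"
    unfolding n_def D_def w_def by algebra
  \<comment> \<open>Since \<open>n - (1 + v) D\<close> is of second order, its square is of fourth order.\<close>
  have "0 \<le> (n - (1 + v) * D)\<^sup>2 / D" using D by simp
  also have "\<dots> = n\<^sup>2 / D - (2 * (1 + v) * n - (1 + v)\<^sup>2 * D)"
    using D by (simp add: power2_eq_square field_simps)
  finally have "2 * (1 + v) * n - (1 + v)\<^sup>2 * D \<le> n\<^sup>2 / D" by simp
  \<comment> \<open>The five bounds add up to \<open>(7 + 3 * E) * \<delta> * q\<close>; the
    constant 10 rounds both coefficients up.\<close>
  moreover have "10 * (1 + E) * \<delta> * q = \<delta> * q + \<delta> * (2 * q) + \<delta> * (2 * (E * q)) + \<delta> * (2 * q)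
      + \<delta> * (2 * q + E * q) + (3 * (\<delta> * q) + 7 * (\<delta> * (E * q)))"
    by (simp add: algebra_simps)
  moreover have "0 \<le> 3 * (\<delta> * q) + 7 * (\<delta> * (E * q))" using \<delta>0 q E by simp
  ultimately show "1 + 2 * u + v + u\<^sup>2 + u * v + v\<^sup>2 + e * u * p - 10 * (1 + E) * \<delta> * (u\<^sup>2 + p\<^sup>2 + v\<^sup>2)
      \<le> (w\<^sup>2 + p\<^sup>2)\<^sup>2 / D"
    using t1 t2 t3 t4 t5 unfolding identity n_def[symmetric] q_def[symmetric] abs_le_iff
    by linarith
qed

context perturbed_arc
begin

text \<open>\<open>D1\<close> and \<open>D2\<close> are the derivatives of \<open>\<phi>\<close> with respect to the angular variable, and \<open>boundary\<close>
  collects the exact derivatives that are split off from the Lagrangian.\<close>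

definition D1 :: "real \<Rightarrow> real" where "D1 s = \<rho> s * \<phi>1 s"
definition D2 :: "real \<Rightarrow> real" where "D2 s = \<rho> s * (\<rho>1 s * \<phi>1 s + \<rho> s * \<phi>2 s)"
definition second_variation :: "real \<Rightarrow> real" where
  "second_variation s = ((D2 s)\<^sup>2 - (1 + \<mu>\<^sup>2) * (D1 s)\<^sup>2 + \<mu>\<^sup>2 * (\<phi> s)\<^sup>2) / \<rho> s"
definition sobolev :: "real \<Rightarrow> real" where
  "sobolev s = ((\<phi> s)\<^sup>2 + (D1 s)\<^sup>2 + (D2 s)\<^sup>2) / \<rho> s"
definition boundary :: "real \<Rightarrow> real" where
  "boundary s = (\<rho> s)\<^sup>2 * \<phi>1 s + 2 * \<mu>\<^sup>2 * (s - L) * \<phi> s + \<rho> s * \<phi> s * \<phi>1 s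
     - (\<rho> s)\<^sup>2 * \<rho>1 s * (\<phi>1 s)\<^sup>2 - (1 - \<mu>\<^sup>2) * (\<phi> s * tangential s)"
definition boundary1 :: "real \<Rightarrow> real" where
  "boundary1 s = (\<rho> s)\<^sup>2 * \<phi>2 s + 2 * \<mu>\<^sup>2 * \<phi> s + \<rho>1 s * \<phi> s * \<phi>1 s + \<rho> s * (\<phi>1 s)\<^sup>2
     + \<rho> s * \<phi> s * \<phi>2 s - \<rho> s * (\<rho>1 s)\<^sup>2 * (\<phi>1 s)\<^sup>2 + \<mu>\<^sup>2 * \<rho> s * (\<phi>1 s)\<^sup>2
     - 2 * (\<rho> s)\<^sup>2 * \<rho>1 s * \<phi>1 s * \<phi>2 s
     - (1 - \<mu>\<^sup>2) * (\<phi>1 s * tangential s - \<phi> s + \<phi> s / \<rho> s * support s)"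

text \<open>The first two terms of \<open>boundary\<close> and the last one account for the linear
  part of the Lagrangian; \<open>\<rho>_\<rho>1\<close> cancels the \<open>\<phi>1\<close>
  contributions of the first two. The third term produces \<open>\<phi> * \<phi>2\<close>, and the
  fourth removes the cross term of \<open>(D2 s)\<^sup>2\<close>.\<close>

lemma boundary_deriv:
  assumes s: "s \<in> {0..2*L}"
  shows "(boundary has_real_derivative boundary1 s) (at s within {0..2*L})"
proof -
  have arc_dom: "s \<in> arc_dom" using s interval_dom by blast
  define r where "r = 1 / \<rho> s"
  have r: "\<rho> s * r = 1" using \<rho>_nz[OF s] by (simp add: r_def)
  note d = \<phi>[OF s] \<phi>1[OF s] \<rho>_deriv[OF arc_dom] \<rho>1_deriv[OF arc_dom] tangential_deriv[OF arc_dom]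
  note h = \<rho>_\<rho>1[OF arc_dom]
  have "(boundary has_real_derivative
      (2 * \<rho> s * \<rho>1 s * \<phi>1 s + (\<rho> s)\<^sup>2 * \<phi>2 s)
      + (2 * \<mu>\<^sup>2 * \<phi> s + 2 * \<mu>\<^sup>2 * (s - L) * \<phi>1 s)
      + (\<rho>1 s * \<phi> s * \<phi>1 s + \<rho> s * \<phi>1 s * \<phi>1 s + \<rho> s * \<phi> s * \<phi>2 s)
      - (2 * \<rho> s * \<rho>1 s * \<rho>1 s * (\<phi>1 s)\<^sup>2 + (\<rho> s)\<^sup>2 * (- (\<mu>\<^sup>2 + (\<rho>1 s)\<^sup>2) * r) * (\<phi>1 s)\<^sup>2
         + (\<rho> s)\<^sup>2 * \<rho>1 s * (2 * \<phi>1 s * \<phi>2 s))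
      - (1 - \<mu>\<^sup>2) * (\<phi>1 s * tangential s + \<phi> s * (support s * r - 1))) (at s within {0..2*L})"
    unfolding boundary_def[abs_def]
    by (rule derivative_eq_intros d refl)+ (simp add: r_def algebra_simps add_divide_distrib diff_divide_distrib)
  moreover have "(2 * \<rho> s * \<rho>1 s * \<phi>1 s + (\<rho> s)\<^sup>2 * \<phi>2 s)
      + (2 * \<mu>\<^sup>2 * \<phi> s + 2 * \<mu>\<^sup>2 * (s - L) * \<phi>1 s)
      + (\<rho>1 s * \<phi> s * \<phi>1 s + \<rho> s * \<phi>1 s * \<phi>1 s + \<rho> s * \<phi> s * \<phi>2 s)
      - (2 * \<rho> s * \<rho>1 s * \<rho>1 s * (\<phi>1 s)\<^sup>2 + (\<rho> s)\<^sup>2 * (- (\<mu>\<^sup>2 + (\<rho>1 s)\<^sup>2) * r) * (\<phi>1 s)\<^sup>2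
         + (\<rho> s)\<^sup>2 * \<rho>1 s * (2 * \<phi>1 s * \<phi>2 s))
      - (1 - \<mu>\<^sup>2) * (\<phi>1 s * tangential s + \<phi> s * (support s * r - 1)) = boundary1 s"
  proof -
    have "\<phi> s / \<rho> s * support s = \<phi> s * (support s * r)" by (simp add: r_def)
    then show ?thesis unfolding boundary1_def using h r by algebra
  qed
  ultimately show ?thesis by simp
qed

text \<open>In the scaled variables \<open>u\<close>, \<open>p\<close>, \<open>v\<close>,
  \<open>e\<close> the quotient bound applies pointwise. Its quadratic polynomial minus the area
  term is exactly the second variation plus \<open>boundary1\<close> and the value on the
  arc.\<close>

lemma density_lower_bound:
  assumes s: "s \<in> {0..2*L}"
    and small: "\<bar>\<phi> s / \<rho> s\<bar> \<le> \<delta>" "\<bar>\<phi>1 s\<bar> \<le> \<delta>" "\<bar>\<rho> s * \<phi>2 s\<bar> \<le> \<delta>"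
    and E: "\<bar>\<rho>1 s\<bar> \<le> E" and \<delta>: "\<delta> * (4 * (1 + E)) \<le> 1"
  shows "0 < scaled_curv s"
    and "\<rho> s - (1 - \<mu>\<^sup>2) * support s + second_variation s + boundary1 s
      - 10 * (1 + E) * (2 + 2 * E\<^sup>2) * \<delta> * sobolev s
      \<le> \<rho> s * (speed2 s)\<^sup>2 / scaled_curv s - (1 - \<mu>\<^sup>2) * area_density s"
proof -
  define u p v e where "u = \<phi> s / \<rho> s" and "p = \<phi>1 s" and "v = \<rho> s * \<phi>2 s" and "e = \<rho>1 s"
  note small' = small[folded u_def v_def p_def] and E' = E[folded e_def]
  have \<rho>: "0 < \<rho> s" using s interval_dom \<rho>_pos by blast
  have curv: "scaled_curv s = (1 + u)\<^sup>2 - (1 + u) * v + 2 * p\<^sup>2 - e * u * p"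
    and speed: "speed2 s = (1 + u)\<^sup>2 + p\<^sup>2"
    unfolding scaled_curv_def speed2_def w_def u_def p_def v_def e_def by simp_all
  show "0 < scaled_curv s"
    unfolding curv by (rule quotient_quadratic_lower_bound[OF small' E' \<delta>])
  have E0: "0 \<le> E" and \<delta>0: "0 \<le> \<delta>" using E small by linarith+
  have "\<phi> s = u * \<rho> s" using \<rho> by (simp add: u_def)
  have sob: "sobolev s = \<rho> s * (u\<^sup>2 + p\<^sup>2 + (e * p + v)\<^sup>2)"
    and sv: "second_variation s = \<rho> s * ((e * p + v)\<^sup>2 - (1 + \<mu>\<^sup>2) * p\<^sup>2 + \<mu>\<^sup>2 * u\<^sup>2)"
    unfolding sobolev_def second_variation_def D1_def D2_def u_def p_def v_def e_def power_mult_distrib power_divide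
    using \<rho> by (simp_all add: power2_eq_square field_simps)
  have b1: "boundary1 s = \<rho> s * v + 2 * \<mu>\<^sup>2 * (u * \<rho> s) + e * (u * \<rho> s) * p + \<rho> s * p\<^sup>2
     + \<rho> s * u * v - \<rho> s * e\<^sup>2 * p\<^sup>2 + \<mu>\<^sup>2 * \<rho> s * p\<^sup>2 - 2 * \<rho> s * e * p * v
     - (1 - \<mu>\<^sup>2) * (p * tangential s - u * \<rho> s + u * support s)"
    unfolding boundary1_def u_def p_def v_def e_def using \<rho> by (simp add: power2_eq_square)
  have area: "area_density s = (1 + u) * support s + p * tangential s + u * \<rho> s * (1 + u)"
    unfolding area_density_def w_def u_def p_def using \<rho> by simp
  \<comment> \<open>No error term arises from the area, whose density is itself quadratic in
    \<open>\<phi>\<close> and \<open>\<phi>1\<close>.\<close>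
  have identity: "\<rho> s - (1 - \<mu>\<^sup>2) * support s + second_variation s + boundary1 s
      = \<rho> s * (1 + 2 * u + v + u\<^sup>2 + u * v + v\<^sup>2 + e * u * p) - (1 - \<mu>\<^sup>2) * area_density s"
    unfolding sv b1 area by algebra
  \<comment> \<open>The Sobolev density contains \<open>e * p + v\<close> in place of
    \<open>v\<close>; splitting off \<open>e * p\<close> costs the factor
    \<open>2 + 2 * E\<^sup>2\<close>.\<close>
  have "v\<^sup>2 \<le> 2 * (e * p + v)\<^sup>2 + 2 * E\<^sup>2 * p\<^sup>2"
  proof -
    have "v\<^sup>2 \<le> 2 * (e * p + v)\<^sup>2 + 2 * (e\<^sup>2 * p\<^sup>2)"
      using zero_le_power2[of "2 * (e * p) + v"] by (simp add: power2_eq_square algebra_simps)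
    moreover have "e\<^sup>2 * p\<^sup>2 \<le> E\<^sup>2 * p\<^sup>2"
      using power_mono[OF E', of 2] by (intro mult_right_mono) auto
    ultimately show ?thesis by simp
  qed
  moreover have "0 \<le> u\<^sup>2 + p\<^sup>2 + 2 * E\<^sup>2 * u\<^sup>2 + 2 * E\<^sup>2 * (e * p + v)\<^sup>2" by simp
  ultimately have "u\<^sup>2 + p\<^sup>2 + v\<^sup>2 \<le> (2 + 2 * E\<^sup>2) * (u\<^sup>2 + p\<^sup>2 + (e * p + v)\<^sup>2)"
    by (simp only: distrib_left distrib_right)
  then have "10 * (1 + E) * \<delta> * (u\<^sup>2 + p\<^sup>2 + v\<^sup>2)
      \<le> 10 * (1 + E) * \<delta> * ((2 + 2 * E\<^sup>2) * (u\<^sup>2 + p\<^sup>2 + (e * p + v)\<^sup>2))"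
    using E0 \<delta>0 by (intro mult_left_mono) auto
  with quotient_quadratic_lower_bound(2)[OF small' E' \<delta>]
  have "1 + 2 * u + v + u\<^sup>2 + u * v + v\<^sup>2 + e * u * p
      - 10 * (1 + E) * \<delta> * ((2 + 2 * E\<^sup>2) * (u\<^sup>2 + p\<^sup>2 + (e * p + v)\<^sup>2)) \<le> (speed2 s)\<^sup>2 / scaled_curv s"
    unfolding curv speed by linarith
  from mult_left_mono[OF this, of "\<rho> s"] \<rho>
  have "\<rho> s * (1 + 2 * u + v + u\<^sup>2 + u * v + v\<^sup>2 + e * u * p)
      - 10 * (1 + E) * (2 + 2 * E\<^sup>2) * \<delta> * sobolev s \<le> \<rho> s * (speed2 s)\<^sup>2 / scaled_curv s"
    unfolding sob by (simp add: right_diff_distrib mult_ac)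
  then show "\<rho> s - (1 - \<mu>\<^sup>2) * support s + second_variation s + boundary1 s
      - 10 * (1 + E) * (2 + 2 * E\<^sup>2) * \<delta> * sobolev s
      \<le> \<rho> s * (speed2 s)\<^sup>2 / scaled_curv s - (1 - \<mu>\<^sup>2) * area_density s"
    unfolding identity by linarith
qed

end

subsection \<open>The angular variable\<close>

context critical_arc
begin

text \<open>Inverse of the tangent angle \<open>\<theta>\<close>, which runs over
  \<open>{-pi..pi}\<close> along the arc.\<close>

definition arclength :: "real \<Rightarrow> real" where "arclength t = L + k * sin (\<mu> * t)"

lemma
  assumes t: "t \<in> {-pi..pi}"
  shows arclength_mem: "arclength t \<in> {0..2*L}"
    and arclength_deriv: "(arclength has_real_derivative \<rho> (arclength t)) (at t within S)"
proof -
  have "\<bar>\<mu> * t\<bar> \<le> \<mu> * pi" unfolding abs_mult using t \<mu>_pos by (intro mult_mono) auto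
  then have *: "- sig x0 L \<le> \<mu> * t" "\<mu> * t \<le> sig x0 L" by (auto simp: sig_eq abs_le_iff mult.commute)
  have "sin (- sig x0 L) \<le> sin (\<mu> * t)" by (rule sin_monotone_2pi_le) (use * sig_less in auto)
  moreover have "sin (\<mu> * t) \<le> sin (sig x0 L)" by (rule sin_monotone_2pi_le) (use * sig_less in auto)
  ultimately have "- L \<le> k * sin (\<mu> * t)" "k * sin (\<mu> * t) \<le> L"
    using k_pos mult_left_mono[of "- sin (sig x0 L)" "sin (\<mu> * t)" k]
      mult_left_mono[of "sin (\<mu> * t)" "sin (sig x0 L)" k] L_eq by auto
  then show "arclength t \<in> {0..2*L}" by (simp add: arclength_def)
  have "ang (arclength t) = \<mu> * t"
    unfolding aa_def arclength_def using k_pos * sig_less by (simp add: arcsin_sin)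
  then have "\<rho> (arclength t) = k * (cos (\<mu> * t) * \<mu>)" by (simp add: \<rho>_def)
  then show "(arclength has_real_derivative \<rho> (arclength t)) (at t within S)"
    unfolding arclength_def by (auto intro!: derivative_eq_intros)
qed

lemma arclength_ends: "arclength (-pi) = 0" "arclength pi = 2 * L"
  using L_eq by (simp_all add: arclength_def sig_eq mult.commute)

lemma arclength_substitution:
  fixes h :: "real \<Rightarrow> real"
  assumes h: "continuous_on {0..2*L} h"
  shows "integral {0..2*L} (\<lambda>s. h s / \<rho> s) = integral {-pi..pi} (\<lambda>t. h (arclength t))"
proof -
  have nz: "\<rho> s \<noteq> 0" if "s \<in> {0..2*L}" for s using \<rho>_pos[of s] that interval_dom by force
  have "((\<lambda>t. \<rho> (arclength t) *\<^sub>R (h (arclength t) / \<rho> (arclength t))) has_integral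
      integral {arclength (-pi)..arclength pi} (\<lambda>s. h s / \<rho> s)) {-pi..pi}"
  proof (rule has_integral_substitution)
    show "continuous_on {0..2*L} (\<lambda>s. h s / \<rho> s)"
      using nz by (intro continuous_intros h \<rho>_cont interval_dom) auto
    show "arclength ` {-pi..pi} \<subseteq> {0..2*L}" using arclength_mem by auto
    show "(arclength has_real_derivative \<rho> (arclength t)) (at t within {-pi..pi})" if "t \<in> {-pi..pi}" for t
      by (rule arclength_deriv[OF that])
  qed (use L_pos in \<open>auto simp: arclength_ends\<close>)
  then have "((\<lambda>t. h (arclength t)) has_integral integral {0..2*L} (\<lambda>s. h s / \<rho> s)) {-pi..pi}"
    unfolding arclength_ends
    by (rule has_integral_eq[rotated]) (use nz[OF arclength_mem] in auto)
  then show ?thesis by (simp add: integral_unique)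
qed

text \<open>The functionals of the arc itself are obtained by specialising the perturbation formulas
  to zero.\<close>

lemma perturbed_arc_zero: "perturbed_arc x0 L (\<lambda>_. 0) (\<lambda>_. 0) (\<lambda>_. 0)"
  by unfold_locales auto

lemma FF_\<gamma>: "FF L \<gamma> = integral {0..2*L} \<rho>"
proof -
  interpret z: perturbed_arc x0 L "\<lambda>_. 0" "\<lambda>_. 0" "\<lambda>_. 0" by (rule perturbed_arc_zero)
  have "perturb \<gamma> (\<lambda>_. 0) = \<gamma>" by (simp add: perturb_def fun_eq_iff)
  with z.FF_perturb show ?thesis by (simp add: z.speed2_def z.scaled_curv_def z.w_def)
qed

lemma AA_\<gamma>: "AA L \<gamma> = 1/2 * integral {0..2*L} support"
proof -
  interpret z: perturbed_arc x0 L "\<lambda>_. 0" "\<lambda>_. 0" "\<lambda>_. 0" by (rule perturbed_arc_zero)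
  have "perturb \<gamma> (\<lambda>_. 0) = \<gamma>" by (simp add: perturb_def fun_eq_iff)
  moreover have "z.area_density = support" by (simp add: z.area_density_def z.w_def fun_eq_iff)
  ultimately show ?thesis using z.AA_perturb by simp
qed

text \<open>Together with the factor 1/2 in \<open>AA\<close>, this turns the multiplier into the
  weight \<open>1 - \<mu>\<^sup>2\<close> used in \<open>boundary\<close>.\<close>

lemma lam_eq: "lam x0 L = 2 * (1 - \<mu>\<^sup>2)"
  unfolding lam_def \<mu>_sq using x0_pos L_pos by (simp add: field_simps)

lemma curvature_variation_bound: "\<exists>E. \<forall>s\<in>{0..2*L}. \<bar>\<rho>1 s\<bar> \<le> E"
  and radius_bounds: "\<exists>m>0. \<forall>s\<in>{0..2*L}. m \<le> \<rho> s" "\<exists>M. \<forall>s\<in>{0..2*L}. \<rho> s \<le> M"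
proof -
  have ne: "{0..2*L} \<noteq> {}" using L_pos by auto
  show "\<exists>E. \<forall>s\<in>{0..2*L}. \<bar>\<rho>1 s\<bar> \<le> E"
    using continuous_attains_sup[OF compact_Icc ne continuous_on_rabs[OF \<rho>1_cont[OF interval_dom]]]
    by blast
  show "\<exists>m>0. \<forall>s\<in>{0..2*L}. m \<le> \<rho> s"
    using continuous_attains_inf[OF compact_Icc ne \<rho>_cont[OF interval_dom]] \<rho>_pos interval_dom by blast
  show "\<exists>M. \<forall>s\<in>{0..2*L}. \<rho> s \<le> M"
    using continuous_attains_sup[OF compact_Icc ne \<rho>_cont[OF interval_dom]] by blast
qed

end

section \<open>Integrated estimates for clamped perturbations\<close>

locale clamped_arc = perturbed_arc +
  assumes clamped: "\<phi> 0 = 0" "\<phi> (2*L) = 0" "\<phi>1 0 = 0" "\<phi>1 (2*L) = 0"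
begin

lemma D_cont: "continuous_on {0..2*L} D1" "continuous_on {0..2*L} D2"
  unfolding D1_def D2_def by (intro continuous_intros arc_cont)+

lemma sobolev_cont: "continuous_on {0..2*L} sobolev" "continuous_on {0..2*L} second_variation"
  unfolding sobolev_def second_variation_def using \<rho>_nz by (auto intro!: continuous_intros arc_cont D_cont)

text \<open>Composed with \<open>arclength\<close>, \<open>D1\<close> and \<open>D2\<close> are the
  first and second derivatives of \<open>\<phi>\<close> in the angular variable, and
  \<open>1 / \<rho>\<close> cancels the Jacobian. The claim becomes
  \<open>second_variation_coercive\<close>.\<close>

lemma second_variation_lower_bound:
  "\<mu>\<^sup>2 / (2 + 12 * exp (2 * pi)) * integral {0..2*L} sobolev \<le> integral {0..2*L} second_variation"
proof -
  have chain: "((\<lambda>t. f (arclength t)) has_real_derivative f' (arclength t) * \<rho> (arclength t)) (at t within {-pi..pi})"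
    if "t \<in> {-pi..pi}" and f: "\<And>s. s \<in> {0..2*L} \<Longrightarrow> (f has_real_derivative f' s) (at s within {0..2*L})"
    for f f' t
  proof -
    have "arclength ` {-pi..pi} \<subseteq> {0..2*L}" using arclength_mem by auto
    then show ?thesis
      using DERIV_image_chain[OF DERIV_subset[OF f[OF arclength_mem[OF that(1)]]] arclength_deriv[OF that(1)]]
      by (simp add: o_def)
  qed
  have D1': "(D1 has_real_derivative \<rho>1 s * \<phi>1 s + \<rho> s * \<phi>2 s) (at s within {0..2*L})"
    if "s \<in> {0..2*L}" for s
    unfolding D1_def[abs_def] using that interval_dom
    by (auto intro!: derivative_eq_intros \<phi>1 \<rho>_deriv)
  have arclength_cont: "continuous_on {-pi..pi} arclength"
    by (rule DERIV_continuous_on[OF arclength_deriv])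
  have "\<mu>\<^sup>2 / (2 + 12 * exp (2 * pi)) * integral {-pi..pi}
      (\<lambda>t. (\<phi> (arclength t))\<^sup>2 + (D1 (arclength t))\<^sup>2 + (D2 (arclength t))\<^sup>2)
    \<le> integral {-pi..pi} (\<lambda>t. (D2 (arclength t))\<^sup>2 - (1 + \<mu>\<^sup>2) * (D1 (arclength t))\<^sup>2
        + \<mu>\<^sup>2 * (\<phi> (arclength t))\<^sup>2)"
  proof (rule second_variation_coercive)
    show "0 \<le> \<mu>" "\<mu> \<le> 1" using \<mu>_pos \<mu>_less by auto
    show "((\<lambda>t. \<phi> (arclength t)) has_real_derivative D1 (arclength t)) (at t within {-pi..pi})"
      if "t \<in> {-pi..pi}" for t
      using chain[OF that \<phi>] by (simp add: D1_def mult.commute)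
    show "((\<lambda>t. D1 (arclength t)) has_real_derivative D2 (arclength t)) (at t within {-pi..pi})"
      if "t \<in> {-pi..pi}" for t
      using chain[OF that D1'] by (simp add: D2_def mult.commute)
    show "continuous_on {-pi..pi} (\<lambda>t. D2 (arclength t))"
      by (rule continuous_on_compose2[OF D_cont(2) arclength_cont]) (use arclength_mem in auto)
  qed (simp_all add: arclength_ends clamped D1_def)
  then show ?thesis
    unfolding sobolev_def[abs_def] second_variation_def[abs_def]
    by (subst (1 2) arclength_substitution) (auto intro!: continuous_intros arc_cont D_cont)
qed

text \<open>Every term of \<open>boundary\<close> has a factor \<open>\<phi>\<close> or
  \<open>\<phi>1\<close>, which vanish at both ends.\<close>

lemma boundary1_integral: "integral {0..2*L} boundary1 = 0" "boundary1 integrable_on {0..2*L}"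
proof -
  have "(boundary1 has_integral boundary (2*L) - boundary 0) {0..2*L}"
    using L_pos boundary_deriv
    by (intro fundamental_theorem_of_calculus) (auto simp: has_real_derivative_iff_has_vector_derivative)
  then show "integral {0..2*L} boundary1 = 0" "boundary1 integrable_on {0..2*L}"
    by (auto simp: boundary_def clamped integral_unique)
qed

text \<open>The density is continuous and nonnegative, so a zero integral would force it, and hence
  \<open>\<phi>\<close>, to vanish everywhere.\<close>

lemma integral_sobolev_pos:
  assumes "\<exists>s\<in>{0..2*L}. \<phi> s \<noteq> 0"
  shows "0 < integral {0..2*L} sobolev"
proof -
  have nonneg: "0 \<le> sobolev s" if "s \<in> {0..2*L}" for s
    using \<rho>_pos[of s] that interval_dom by (auto simp: sobolev_def)
  obtain s where s: "s \<in> {0..2*L}" "\<phi> s \<noteq> 0" using assms by blast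
  then have "0 < (\<phi> s)\<^sup>2 + (D1 s)\<^sup>2 + (D2 s)\<^sup>2" by (intro add_pos_nonneg) auto
  then have "sobolev s \<noteq> 0" using \<rho>_nz[OF s(1)] by (simp add: sobolev_def)
  then have "integral {0..2*L} sobolev \<noteq> 0"
    using integral_eq_0_iff[OF sobolev_cont(1) _ nonneg] L_pos s(1) by auto
  moreover have "0 \<le> integral {0..2*L} sobolev"
    by (intro integral_nonneg integrable_continuous_real sobolev_cont nonneg)
  ultimately show ?thesis by simp
qed

text \<open>Integration of \<open>density_lower_bound\<close>: the exact derivative drops out and
  coercivity competes with the cubic error, both measured by the same Sobolev integral.\<close>

lemma energy_gap:
  assumes small: "\<And>s. s \<in> {0..2*L} \<Longrightarrow>
      \<bar>\<phi> s / \<rho> s\<bar> \<le> \<delta> \<and> \<bar>\<phi>1 s\<bar> \<le> \<delta> \<and> \<bar>\<rho> s * \<phi>2 s\<bar> \<le> \<delta> \<and> \<bar>\<rho>1 s\<bar> \<le> E"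
    and \<delta>: "\<delta> * (4 * (1 + E)) \<le> 1"
  shows "FF L \<gamma> - lam x0 L * AA L \<gamma> + (\<mu>\<^sup>2 / (2 + 12 * exp (2 * pi)) - 10 * (1 + E) * (2 + 2 * E\<^sup>2) * \<delta>)
        * integral {0..2*L} sobolev
      \<le> FF L (perturb \<gamma> \<phi>) - lam x0 L * AA L (perturb \<gamma> \<phi>)"
proof -
  define K where "K = 10 * (1 + E) * (2 + 2 * E\<^sup>2) * \<delta>"
  have pos: "scaled_curv s \<noteq> 0" if "s \<in> {0..2*L}" for s
    using density_lower_bound(1)[OF that _ _ _ _ \<delta>] small[OF that] by force
  have I: "(h has_integral integral {0..2*L} h) {0..2*L}" if "continuous_on {0..2*L} h" for h :: "real \<Rightarrow> real"
    by (intro integrable_integral integrable_continuous_real that)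
  have b: "(boundary1 has_integral 0) {0..2*L}"
    using boundary1_integral by (simp add: has_integral_integral)
  have "((\<lambda>s. \<rho> s - (1 - \<mu>\<^sup>2) * support s + second_variation s + boundary1 s - K * sobolev s) has_integral
      integral {0..2*L} \<rho> - (1 - \<mu>\<^sup>2) * integral {0..2*L} support + integral {0..2*L} second_variation + 0
      - K * integral {0..2*L} sobolev) {0..2*L}"
    by (intro has_integral_add has_integral_diff has_integral_mult_right b I arc_cont sobolev_cont)
  moreover have "((\<lambda>s. \<rho> s * (speed2 s)\<^sup>2 / scaled_curv s - (1 - \<mu>\<^sup>2) * area_density s) has_integral
      integral {0..2*L} (\<lambda>s. \<rho> s * (speed2 s)\<^sup>2 / scaled_curv s) - (1 - \<mu>\<^sup>2) * integral {0..2*L} area_density) {0..2*L}"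
    using pos by (intro has_integral_diff has_integral_mult_right I continuous_intros density_cont arc_cont) auto
  ultimately have "integral {0..2*L} \<rho> - (1 - \<mu>\<^sup>2) * integral {0..2*L} support
      + integral {0..2*L} second_variation + 0 - K * integral {0..2*L} sobolev
      \<le> integral {0..2*L} (\<lambda>s. \<rho> s * (speed2 s)\<^sup>2 / scaled_curv s) - (1 - \<mu>\<^sup>2) * integral {0..2*L} area_density"
  proof (rule has_integral_le)
    fix s assume s: "s \<in> {0..2*L}"
    show "\<rho> s - (1 - \<mu>\<^sup>2) * support s + second_variation s + boundary1 s - K * sobolev s
      \<le> \<rho> s * (speed2 s)\<^sup>2 / scaled_curv s - (1 - \<mu>\<^sup>2) * area_density s"
      unfolding K_def using small[OF s] by (intro density_lower_bound(2)[OF s _ _ _ _ \<delta>]) auto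
  qed
  moreover have "lam x0 L * (1/2 * x) = (1 - \<mu>\<^sup>2) * x" for x
    by (simp add: lam_eq)
  ultimately show ?thesis
    using second_variation_lower_bound
    unfolding FF_\<gamma> AA_\<gamma> FF_perturb AA_perturb K_def[symmetric] left_diff_distrib[of _ K]
    by (simp only: add_0_right)
qed

end

text \<open>Compactness provides bounds for \<open>\<rho>\<close> and \<open>\<rho>1\<close> that
  depend on the arc alone, so \<open>\<epsilon>\<close> is uniform in the perturbation.\<close>

lemma (in critical_arc) local_minimality:
  "\<exists>\<epsilon>>0. \<forall>\<phi> \<phi>1 \<phi>2. perturbed_arc x0 L \<phi> \<phi>1 \<phi>2 \<longrightarrow>
     \<phi> 0 = 0 \<longrightarrow> \<phi> (2*L) = 0 \<longrightarrow> \<phi>1 0 = 0 \<longrightarrow> \<phi>1 (2*L) = 0 \<longrightarrow>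
     (\<exists>s\<in>{0..2*L}. \<phi> s \<noteq> 0) \<longrightarrow>
     (\<forall>s\<in>{0..2*L}. \<bar>\<phi> s\<bar> \<le> \<epsilon> \<and> \<bar>\<phi>1 s\<bar> \<le> \<epsilon> \<and> \<bar>\<phi>2 s\<bar> \<le> \<epsilon>) \<longrightarrow>
     FF L \<gamma> - lam x0 L * AA L \<gamma> < FF L (perturb \<gamma> \<phi>) - lam x0 L * AA L (perturb \<gamma> \<phi>)"
proof -
  obtain E where E: "\<And>s. s \<in> {0..2*L} \<Longrightarrow> \<bar>\<rho>1 s\<bar> \<le> E" using curvature_variation_bound by blast
  obtain m where m: "0 < m" "\<And>s. s \<in> {0..2*L} \<Longrightarrow> m \<le> \<rho> s" using radius_bounds(1) by blast
  obtain M where M: "\<And>s. s \<in> {0..2*L} \<Longrightarrow> \<rho> s \<le> M" using radius_bounds(2) by blast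
  have E0: "0 \<le> E" using E[of 0] L_pos by auto
  have M0: "0 < M" using m(1) m(2)[of 0] M[of 0] L_pos by auto
  define c where "c = \<mu>\<^sup>2 / (2 + 12 * exp (2 * pi))"
  define K where "K = 10 * (1 + E) * (2 + 2 * E\<^sup>2)"
  have c: "0 < c" unfolding c_def using \<mu>_pos by (intro divide_pos_pos add_pos_pos) auto
  have K: "0 < K" unfolding K_def using E0 by (intro mult_pos_pos add_pos_nonneg) auto
  \<comment> \<open>The first entry meets the smallness condition of the quotient bound; the second
    keeps the error constant at most half the coercivity constant.\<close>
  define \<delta> where "\<delta> = min (1 / (4 * (1 + E))) (c / (2 * K))"
  have \<delta>: "0 < \<delta>" "\<delta> * (4 * (1 + E)) \<le> 1" "K * \<delta> < c"
  proof -
    show "0 < \<delta>" using E0 c K by (auto simp: \<delta>_def)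
    have "\<delta> \<le> 1 / (4 * (1 + E))" by (simp add: \<delta>_def)
    then show "\<delta> * (4 * (1 + E)) \<le> 1" using E0 by (simp add: le_divide_eq)
    have "\<delta> \<le> c / (2 * K)" by (simp add: \<delta>_def)
    then have "K * \<delta> \<le> c / 2" using K by (simp add: field_simps)
    then show "K * \<delta> < c" using c by linarith
  qed
  \<comment> \<open>The entries control \<open>\<phi>1\<close>, \<open>\<phi> / \<rho>\<close> and
    \<open>\<rho> * \<phi>2\<close>, in this order, by means of \<open>m\<close> and
    \<open>M\<close>.\<close>
  define \<epsilon> where "\<epsilon> = min \<delta> (min (m * \<delta>) (\<delta> / M))"
  have \<epsilon>: "0 < \<epsilon>" "\<epsilon> \<le> \<delta>" "\<epsilon> \<le> m * \<delta>" "\<epsilon> \<le> \<delta> / M" using \<delta>(1) m(1) M0 by (auto simp: \<epsilon>_def)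
  show ?thesis
  proof (intro exI[of _ \<epsilon>] conjI allI impI \<epsilon>)
    fix \<phi> \<phi>1 \<phi>2 :: "real \<Rightarrow> real"
    assume "perturbed_arc x0 L \<phi> \<phi>1 \<phi>2" and clamped: "\<phi> 0 = 0" "\<phi> (2*L) = 0" "\<phi>1 0 = 0" "\<phi>1 (2*L) = 0"
      and nz: "\<exists>s\<in>{0..2*L}. \<phi> s \<noteq> 0"
      and small: "\<forall>s\<in>{0..2*L}. \<bar>\<phi> s\<bar> \<le> \<epsilon> \<and> \<bar>\<phi>1 s\<bar> \<le> \<epsilon> \<and> \<bar>\<phi>2 s\<bar> \<le> \<epsilon>"
    then interpret perturbed_arc x0 L \<phi> \<phi>1 \<phi>2 by simp
    interpret clamped_arc x0 L \<phi> \<phi>1 \<phi>2 by unfold_locales (fact clamped)+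
    have "\<bar>\<phi> s / \<rho> s\<bar> \<le> \<delta> \<and> \<bar>\<phi>1 s\<bar> \<le> \<delta> \<and> \<bar>\<rho> s * \<phi>2 s\<bar> \<le> \<delta> \<and> \<bar>\<rho>1 s\<bar> \<le> E" if s: "s \<in> {0..2*L}" for s
    proof (intro conjI E[OF s])
      have \<rho>: "0 < \<rho> s" using m(1) m(2)[OF s] by linarith
      have "\<bar>\<phi> s\<bar> \<le> m * \<delta>" using small s \<epsilon> by force
      also have "\<dots> \<le> \<rho> s * \<delta>" using m(2)[OF s] \<delta> by (intro mult_right_mono) auto
      finally show "\<bar>\<phi> s / \<rho> s\<bar> \<le> \<delta>" using \<rho> by (simp add: divide_le_eq mult.commute)
      show "\<bar>\<phi>1 s\<bar> \<le> \<delta>" using small s \<epsilon> by force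
      have "\<bar>\<rho> s * \<phi>2 s\<bar> \<le> M * (\<delta> / M)"
        unfolding abs_mult
      proof (rule mult_mono)
        show "\<bar>\<rho> s\<bar> \<le> M" using \<rho> M[OF s] by simp
        show "\<bar>\<phi>2 s\<bar> \<le> \<delta> / M" using small s \<epsilon> by force
      qed (use M0 in auto)
      then show "\<bar>\<rho> s * \<phi>2 s\<bar> \<le> \<delta>" using M0 by simp
    qed
    note gap = energy_gap[OF this \<delta>(2), folded c_def K_def]
    have "0 < (c - K * \<delta>) * integral {0..2*L} sobolev"
      using \<delta>(3) integral_sobolev_pos[OF nz] by simp
    then show "FF L \<gamma> - lam x0 L * AA L \<gamma> < FF L (perturb \<gamma> \<phi>) - lam x0 L * AA L (perturb \<gamma> \<phi>)"
      using gap by linarith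
  qed
qed

subsection \<open>The enclosed area\<close>

text \<open>The area with \<open>L\<close> eliminated through
  \<open>L = x0 * (pi\<^sup>2 / \<sigma>\<^sup>2 - 1)\<close>, arranged so that every factor
  depending on \<sigma> is visibly decreasing.\<close>

definition arc_area :: "real \<Rightarrow> real \<Rightarrow> real" where
  "arc_area x0 \<sigma> = 1/2 * pi * x0\<^sup>2 *
     ((pi\<^sup>2 / \<sigma>\<^sup>2 - 1) * (1 / (sin \<sigma>)\<^sup>2) + (pi\<^sup>2 / \<sigma>\<^sup>2 + 1) / \<sigma> * (cos \<sigma> / sin \<sigma>))"

context critical_arc
begin

lemma \<alpha>\<beta>: "\<alpha> * \<beta> = L / x0"
proof -
  have "\<alpha> * \<beta> = 1 / \<mu>\<^sup>2 - 1" by (simp add: \<alpha>_def \<beta>_def power2_eq_square algebra_simps)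
  also have "\<dots> = L / x0" unfolding \<mu>_sq using x0_pos L_pos by (simp add: field_simps)
  finally show ?thesis .
qed

lemma ang_ends: "ang 0 = - sig x0 L" "ang (2*L) = sig x0 L"
proof -
  have "ang (2*L) = arcsin (sin (sig x0 L))" using L_pos by (simp add: aa_def kk_def)
  then show "ang (2*L) = sig x0 L" using sig_pos sig_less by (simp add: arcsin_sin)
  have "ang 0 = arcsin (sin (- sig x0 L))" using L_pos by (simp add: aa_def kk_def)
  then show "ang 0 = - sig x0 L" using sig_pos sig_less by (simp only:) (simp add: arcsin_sin del: sin_minus)
qed

text \<open>At the right end the phases are pi + \<sigma> and pi - \<sigma>, so the sum is
  \<open>sin \<sigma> * (1 / \<beta> - 1 / \<alpha>)\<close>; then
  \<open>\<alpha> - \<beta> = 2\<close> and \<open>\<alpha>\<beta>\<close> give the value. The left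
  end follows by oddness.\<close>

lemma \<gamma>_fst_end: "fst (\<gamma> (2*L)) = - x0" "fst (\<gamma> 0) = x0"
proof -
  have a: "\<alpha> * sig x0 L = pi + sig x0 L" and b: "\<beta> * sig x0 L = pi - sig x0 L"
    unfolding frequencies[symmetric] using sig_pos by simp_all
  have "sin (\<alpha> * sig x0 L) / \<alpha> + sin (\<beta> * sig x0 L) / \<beta> = sin (sig x0 L) * ((\<alpha> - \<beta>) / (\<alpha> * \<beta>))"
    unfolding a b using \<alpha>_pos \<beta>_pos by (simp add: sin_add sin_diff field_simps)
  also have "(\<alpha> - \<beta>) / (\<alpha> * \<beta>) = 2 * x0 / L" unfolding \<alpha>\<beta> by (simp add: \<alpha>_def \<beta>_def)
  finally have *: "k * (sin (\<alpha> * sig x0 L) / \<alpha> + sin (\<beta> * sig x0 L) / \<beta>) = 2 * x0"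
    using sin_sig_pos L_pos by (simp add: kk_def)
  show "fst (\<gamma> (2*L)) = - x0" unfolding \<gamma>_fst ang_ends using * by simp
  show "fst (\<gamma> 0) = x0" unfolding \<gamma>_fst ang_ends using * by (simp add: algebra_simps)
qed

lemma support_eq: "support s = k / 2 * (1 / \<alpha> + 1 / \<beta>) * cos (ang s) + y0 * cos (\<theta> s)"
proof -
  have "cos (\<alpha> * ang s) * cos (\<theta> s) + sin (\<alpha> * ang s) * sin (\<theta> s) = cos (ang s)"
    using cos_diff[of "\<alpha> * ang s" "\<theta> s"] by (simp add: \<alpha>_ang)
  moreover have "cos (\<beta> * ang s) * cos (\<theta> s) + sin (\<beta> * ang s) * sin (\<theta> s) = cos (ang s)"
    using cos_diff[of "\<beta> * ang s" "\<theta> s"] by (simp add: \<beta>_ang)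
  moreover have "support s = k / 2 * ((cos (\<alpha> * ang s) * cos (\<theta> s) + sin (\<alpha> * ang s) * sin (\<theta> s)) / \<alpha>
      + (cos (\<beta> * ang s) * cos (\<theta> s) + sin (\<beta> * ang s) * sin (\<theta> s)) / \<beta>) + y0 * cos (\<theta> s)"
    unfolding support_def \<gamma>_fst \<gamma>_snd by (simp add: algebra_simps add_divide_distrib)
  ultimately show ?thesis by (simp add: algebra_simps)
qed

lemma AA_\<gamma>_eq: "AA L \<gamma> = arc_area x0 (sig x0 L)"
proof -
  define q where "q = 1 / \<alpha> + 1 / \<beta>"
  \<comment> \<open>An antiderivative of \<open>support\<close>: in the variable \<open>ang\<close>
    the first term of \<open>support_eq\<close> becomes a squared cosine, and
    \<open>cos (\<theta> s)\<close> is minus the derivative of the first coordinate.\<close>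
  define G where "G s = k\<^sup>2 / 4 * q * (ang s + sin (ang s) * cos (ang s)) - y0 * fst (\<gamma> s)" for s
  have "(G has_real_derivative support s) (at s within {0..2*L})" if "s \<in> {0..2*L}" for s
  proof -
    have arc_dom: "s \<in> arc_dom" using that interval_dom by blast
    define r where "r = \<mu> / \<rho> s"
    have r: "k * cos (ang s) * r = 1" using \<rho>_ang[OF arc_dom] by (simp only: r_def)
    have cS: "(sin (ang s))\<^sup>2 + (cos (ang s))\<^sup>2 = 1" by simp
    define X where "X = r + (cos (ang s) * r * cos (ang s) + - sin (ang s) * r * sin (ang s))"
    have "(G has_real_derivative k\<^sup>2 / 4 * q * X - y0 * - cos (\<theta> s)) (at s within {0..2*L})"
      unfolding G_def[abs_def] X_def
      by (rule derivative_eq_intros ang_deriv[OF arc_dom, folded r_def] \<gamma>_fst_deriv[OF arc_dom] refl)+ simp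
    moreover have "k\<^sup>2 * X = 2 * k * cos (ang s)"
      unfolding X_def using r cS by algebra
    moreover have "k\<^sup>2 / 4 * q * X = q / 4 * (k\<^sup>2 * X)" by simp
    ultimately have "(G has_real_derivative q / 4 * (2 * k * cos (ang s)) - y0 * - cos (\<theta> s))
        (at s within {0..2*L})" by (simp only:)
    then show ?thesis unfolding support_eq q_def[symmetric] by (simp add: mult_ac)
  qed
  then have "(support has_integral G (2*L) - G 0) {0..2*L}"
    using L_pos by (intro fundamental_theorem_of_calculus) (auto simp: has_real_derivative_iff_has_vector_derivative)
  then have "AA L \<gamma> = 1/2 * (G (2*L) - G 0)" by (simp add: AA_\<gamma> integral_unique)
  also have "G (2*L) - G 0 = k\<^sup>2 / 2 * q * (sig x0 L + sin (sig x0 L) * cos (sig x0 L)) + 2 * y0 * x0"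
    unfolding G_def ang_ends \<gamma>_fst_end by (simp add: field_simps)
  also have "q = 2 / \<mu> * (x0 / L)"
  proof -
    have "q = (\<alpha> + \<beta>) / (\<alpha> * \<beta>)" using \<alpha>_pos \<beta>_pos by (simp add: q_def field_simps)
    then show ?thesis unfolding \<alpha>\<beta> by (simp add: \<alpha>_def \<beta>_def)
  qed
  finally have AA: "AA L \<gamma> = 1/2 * (k\<^sup>2 / 2 * (2 / \<mu> * (x0 / L)) * (sig x0 L + sin (sig x0 L) * cos (sig x0 L)) + 2 * y0 * x0)" .
  define \<sigma> where "\<sigma> = sig x0 L"
  define S c where "S = sin \<sigma>" and "c = cos \<sigma>"
  have pos: "0 < \<sigma>" "0 < S" "0 < c" using sig_pos sin_sig_pos cos_sig_pos by (auto simp: \<sigma>_def S_def c_def)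
  have mu: "\<mu> = \<sigma> / pi" by (simp add: \<sigma>_def sig_eq)
  have L: "L = x0 * (pi\<^sup>2 / \<sigma>\<^sup>2 - 1)"
    using \<mu>_sq x0_pos L_pos pos unfolding mu by (simp add: power_divide field_simps)
  have kL: "k\<^sup>2 * (x0 / L) = x0 * L / S\<^sup>2"
    using L_pos pos by (simp add: kk_def S_def \<sigma>_def power2_eq_square field_simps)
  have y: "y0 = pi * x0 * c / (\<sigma> * S)"
    by (simp add: y0_def tan_def S_def c_def \<sigma>_def)
  have "AA L \<gamma> = 1/2 * ((k\<^sup>2 * (x0 / L)) / \<mu> * (\<sigma> + S * c) + 2 * y0 * x0)"
    unfolding AA \<sigma>_def[symmetric] S_def[symmetric] c_def[symmetric] by simp
  also have "\<dots> = 1/2 * (x0 * (x0 * (pi\<^sup>2 / \<sigma>\<^sup>2 - 1)) / S\<^sup>2 / (\<sigma> / pi) * (\<sigma> + S * c) + 2 * (pi * x0 * c / (\<sigma> * S)) * x0)"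
    unfolding kL unfolding y mu by (subst L) simp
  also have "\<dots> = arc_area x0 \<sigma>"
    unfolding arc_area_def S_def[symmetric] c_def[symmetric] using pos
    by (simp add: field_simps power2_eq_square)
  finally show ?thesis by (simp only: \<sigma>_def)
qed

end

text \<open>Strictness is taken from the first product; the second one is compared weakly, since its
  cosine may vanish at \<open>b = pi/2\<close>.\<close>

lemma arc_area_strict_antimono:
  assumes "0 < x0" "0 < a" "a < b" "b \<le> pi/2"
  shows "arc_area x0 b < arc_area x0 a"
proof -
  have sin: "0 < sin a" "sin a < sin b"
    using assms by (auto intro!: sin_gt_zero sin_monotone_2pi)
  have cos: "0 \<le> cos b" "cos b \<le> cos a"
    using assms by (auto intro!: cos_ge_zero cos_monotone_0_pi_le)
  have sq: "a\<^sup>2 < b\<^sup>2" using assms by (intro power_strict_mono) auto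
  have "b\<^sup>2 < pi\<^sup>2" using assms pi_gt_zero by (intro power_strict_mono) linarith+
  then have 1: "0 < pi\<^sup>2 / b\<^sup>2 - 1" using assms by simp
  have 2: "pi\<^sup>2 / b\<^sup>2 < pi\<^sup>2 / a\<^sup>2" using assms sq by (intro divide_strict_left_mono) auto
  have 3: "1 / (sin b)\<^sup>2 \<le> 1 / (sin a)\<^sup>2" using sin by (intro divide_left_mono power_mono) auto
  have "(pi\<^sup>2 / b\<^sup>2 - 1) * (1 / (sin b)\<^sup>2) < (pi\<^sup>2 / a\<^sup>2 - 1) * (1 / (sin a)\<^sup>2)"
    using 1 2 3 sin by (intro mult_less_le_imp_less) auto
  moreover have "(pi\<^sup>2 / b\<^sup>2 + 1) / b * (cos b / sin b) \<le> (pi\<^sup>2 / a\<^sup>2 + 1) / a * (cos a / sin a)"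
    using 1 2 sin cos assms by (intro mult_mono frac_le) auto
  ultimately show ?thesis
    unfolding arc_area_def using assms by (intro mult_strict_left_mono add_less_le_mono) auto
qed

text \<open>Intermediate values: at \<open>pi/2\<close> the area equals the excluded bound, and near
  zero it is large.\<close>

lemma arc_area_surj:
  assumes "0 < x0" and A0: "3/2 * pi * x0\<^sup>2 < A0"
  obtains \<sigma> where "0 < \<sigma>" "\<sigma> < pi/2" "arc_area x0 \<sigma> = A0"
proof -
  define B where "B = 2 * A0 / (pi * x0\<^sup>2)"
  have B: "3 < B" using assms by (simp add: B_def field_simps)
  \<comment> \<open>Chosen so that \<open>pi\<^sup>2 / a\<^sup>2 - 1 = B\<close>; this factor alone
    already gives the area \<open>A0\<close>, and \<open>B > 3\<close> places \<open>a\<close> below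
    \<open>pi/2\<close>.\<close>
  define a where "a = pi / sqrt (1 + B)"
  have "2 < sqrt (1 + B)" using B by (intro real_less_rsqrt) simp
  then have "pi / sqrt (1 + B) < pi / 2" by (intro divide_strict_left_mono) (use B in auto)
  then have a: "0 < a" "a < pi/2" using B by (auto simp: a_def)
  have "sin a > 0" using a by (intro sin_gt_zero) auto
  have half: "arc_area x0 (pi/2) = 3/2 * pi * x0\<^sup>2" by (simp add: arc_area_def power_divide)
  have "A0 = 1/2 * pi * x0\<^sup>2 * (B * 1 + 0)" using assms by (simp add: B_def)
  also have "\<dots> \<le> arc_area x0 a"
    unfolding arc_area_def
  proof (intro mult_left_mono add_mono mult_mono)
    show "B \<le> pi\<^sup>2 / a\<^sup>2 - 1" using B by (simp add: a_def power_divide)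
    then show "0 \<le> pi\<^sup>2 / a\<^sup>2 - 1" using B by linarith
    show "1 \<le> 1 / (sin a)\<^sup>2" using \<open>sin a > 0\<close> by (simp add: power_le_one)
    show "0 \<le> (pi\<^sup>2 / a\<^sup>2 + 1) / a * (cos a / sin a)"
      using \<open>sin a > 0\<close> a by (intro mult_nonneg_nonneg divide_nonneg_pos cos_ge_zero) auto
  qed (use assms in auto)
  finally have "A0 \<le> arc_area x0 a" .
  moreover have "continuous_on {a..pi/2} (arc_area x0)"
    unfolding arc_area_def using a
    by (intro continuous_intros) (auto intro!: less_imp_neq[symmetric] sin_gt_zero)
  ultimately obtain \<sigma> where \<sigma>: "a \<le> \<sigma>" "\<sigma> \<le> pi/2" "arc_area x0 \<sigma> = A0"
    using IVT2'[of "arc_area x0" "pi/2" A0 a] half A0 a by auto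
  show ?thesis
  proof (rule that)
    show "\<sigma> < pi/2" using \<sigma> half A0 by (cases "\<sigma> = pi/2") auto
  qed (use \<sigma> a in auto)
qed

text \<open>The description in \<open>LL\<close> is meaningful only after unique existence.
  Existence comes from \<open>arc_area_surj\<close>, uniqueness from
  \<open>arc_area_strict_antimono\<close> and the injectivity of \<open>sig\<close> in the
  length.\<close>

lemma LL_gt:
  assumes x0: "0 < x0" and A0: "3/2 * pi * x0\<^sup>2 < A0"
  shows "3 * x0 < LL x0 A0"
proof -
  obtain \<sigma> where \<sigma>: "0 < \<sigma>" "\<sigma> < pi/2" "arc_area x0 \<sigma> = A0" using arc_area_surj[OF assms] .
  \<comment> \<open>The solution of \<open>sig x0 L = \<sigma>\<close>; the bound
    \<open>\<sigma> < pi/2\<close> corresponds to \<open>3 * x0 < L\<close>.\<close>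
  define L where "L = x0 * (pi\<^sup>2 / \<sigma>\<^sup>2 - 1)"
  have "(2 * \<sigma>)\<^sup>2 < pi\<^sup>2" using \<sigma> by (intro power_strict_mono) auto
  then have "4 < pi\<^sup>2 / \<sigma>\<^sup>2" using \<sigma> by (simp add: power_mult_distrib less_divide_eq)
  then have "x0 * 3 < x0 * (pi\<^sup>2 / \<sigma>\<^sup>2 - 1)" using x0 by (intro mult_strict_left_mono) auto
  then have L: "3 * x0 < L" by (simp add: L_def mult.commute)
  have "L + x0 = x0 * (pi / \<sigma>)\<^sup>2" by (simp add: L_def power_divide right_diff_distrib)
  then have "x0 / (L + x0) = (\<sigma> / pi)\<^sup>2" using x0 by (simp add: power_divide)
  then have "sig x0 L = \<sigma>" using \<sigma> by (simp add: sig_def)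
  then have "AA L (gamma_crv x0 L) = A0"
    using critical_arc.AA_\<gamma>_eq[of x0 L] x0 L \<sigma> by (simp add: critical_arc_def)
  moreover have "M = L" if M: "3 * x0 < M" and AM: "AA M (gamma_crv x0 M) = A0" for M
  proof -
    interpret M: critical_arc x0 M using x0 M by unfold_locales
    have "arc_area x0 (sig x0 M) = arc_area x0 \<sigma>" using M.AA_\<gamma>_eq AM \<sigma> by simp
    then have "sig x0 M = \<sigma>"
      using arc_area_strict_antimono[OF x0, of \<sigma> "sig x0 M"] arc_area_strict_antimono[OF x0, of "sig x0 M" \<sigma>]
        M.sig_pos M.sig_less \<sigma> by (cases "sig x0 M" \<sigma> rule: linorder_cases) auto
    then have "sig x0 M = sig x0 L" using \<open>sig x0 L = \<sigma>\<close> by simp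
    then have "x0 / (M + x0) = x0 / (L + x0)" by (simp add: sig_def)
    then show "M = L" using x0 by simp
  qed
  ultimately have "\<exists>!L. 3 * x0 < L \<and> AA L (gamma_crv x0 L) = A0" using L by blast
  from theI'[OF this] show ?thesis unfolding LL_def by blast
qed

text \<open>The C2 regularity up to the end points is expressed by explicit derivatives
  \<open>\<phi>1\<close> and \<open>\<phi>2\<close> within the closed interval. Under equal areas
  the multiplier terms cancel, which gives the second claim.\<close>

theorem mainTheorem20:
  fixes x0 A0 :: real
  assumes "x0 > 0" and "A0 > 3/2 * pi * x0\<^sup>2"
  defines "L \<equiv> LL x0 A0"
  defines "\<gamma> \<equiv> gamma_crv x0 L"
  defines "lm \<equiv> lam x0 L"
  shows "\<exists>\<epsilon>>0. \<forall>\<phi> \<phi>1 \<phi>2 :: real \<Rightarrow> real.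
     (\<forall>s\<in>{0..2*L}. (\<phi> has_real_derivative \<phi>1 s) (at s within {0..2*L})
                  \<and> (\<phi>1 has_real_derivative \<phi>2 s) (at s within {0..2*L})) \<and>
     continuous_on {0..2*L} \<phi>2 \<and>
     \<phi> 0 = 0 \<and> \<phi> (2*L) = 0 \<and> \<phi>1 0 = 0 \<and> \<phi>1 (2*L) = 0 \<and>
     (\<exists>s\<in>{0..2*L}. \<phi> s \<noteq> 0) \<and>
     (\<forall>s\<in>{0..2*L}. \<bar>\<phi> s\<bar> \<le> \<epsilon> \<and> \<bar>\<phi>1 s\<bar> \<le> \<epsilon> \<and> \<bar>\<phi>2 s\<bar> \<le> \<epsilon>)
     \<longrightarrow>
       FF L \<gamma> - lm * AA L \<gamma> < FF L (perturb \<gamma> \<phi>) - lm * AA L (perturb \<gamma> \<phi>)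
     \<and> (AA L (perturb \<gamma> \<phi>) = AA L \<gamma> \<longrightarrow> FF L \<gamma> < FF L (perturb \<gamma> \<phi>))"
proof -
  interpret critical_arc x0 L
    using assms(1) LL_gt[OF assms(1,2)] by unfold_locales (simp_all add: L_def)
  obtain \<epsilon> where \<epsilon>: "0 < \<epsilon>"
    and minimal: "\<And>\<phi> \<phi>1 \<phi>2. \<lbrakk>perturbed_arc x0 L \<phi> \<phi>1 \<phi>2; \<phi> 0 = 0; \<phi> (2*L) = 0; \<phi>1 0 = 0; \<phi>1 (2*L) = 0;
      \<exists>s\<in>{0..2*L}. \<phi> s \<noteq> 0; \<forall>s\<in>{0..2*L}. \<bar>\<phi> s\<bar> \<le> \<epsilon> \<and> \<bar>\<phi>1 s\<bar> \<le> \<epsilon> \<and> \<bar>\<phi>2 s\<bar> \<le> \<epsilon>\<rbrakk>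
      \<Longrightarrow> FF L \<gamma> - lm * AA L \<gamma> < FF L (perturb \<gamma> \<phi>) - lm * AA L (perturb \<gamma> \<phi>)"
    using local_minimality unfolding \<gamma>_def lm_def by blast
  show ?thesis
  proof (intro exI[of _ \<epsilon>] conjI allI impI \<epsilon>; elim conjE)
    fix \<phi> \<phi>1 \<phi>2 :: "real \<Rightarrow> real"
    assume hyps: "\<forall>s\<in>{0..2*L}. (\<phi> has_real_derivative \<phi>1 s) (at s within {0..2*L})
        \<and> (\<phi>1 has_real_derivative \<phi>2 s) (at s within {0..2*L})" "continuous_on {0..2*L} \<phi>2"
      "\<phi> 0 = 0" "\<phi> (2*L) = 0" "\<phi>1 0 = 0" "\<phi>1 (2*L) = 0" "\<exists>s\<in>{0..2*L}. \<phi> s \<noteq> 0"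
      "\<forall>s\<in>{0..2*L}. \<bar>\<phi> s\<bar> \<le> \<epsilon> \<and> \<bar>\<phi>1 s\<bar> \<le> \<epsilon> \<and> \<bar>\<phi>2 s\<bar> \<le> \<epsilon>"
    have "perturbed_arc x0 L \<phi> \<phi>1 \<phi>2" using hyps(1,2) by unfold_locales auto
    then show gap: "FF L \<gamma> - lm * AA L \<gamma> < FF L (perturb \<gamma> \<phi>) - lm * AA L (perturb \<gamma> \<phi>)"
      by (rule minimal) (use hyps in auto)
    assume "AA L (perturb \<gamma> \<phi>) = AA L \<gamma>"
    with gap show "FF L \<gamma> < FF L (perturb \<gamma> \<phi>)" by simp
  qed
qed

end
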